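(* Let $E$ be a graph and $w\in E^0$ with $s_E^{-1}(w)=\{e\}$ and $t_E(e)\neq w$. Let $E_{R+}$ be the unital reduction of $E$ at $w$, and let $f_*\colon C^*(E_{R+})\to C^*(E)$ be the $*$-isomorphism given by $f_*(S_p)=S_p$ for $p\in E_{R+}^0\sqcup(E^1\setminus t_E^{-1}(w))$ and $f_*(S_{ge})=S_gS_e$ for the edges $ge$ of $E_{R+}$ with $t_E(g)=w$. Then the maps $\varphi^0\colon E^0\to S(E_{R+})$ and $\varphi^1\colon E^1\to S(E_{R+})$ given by $$\varphi^0(u)=\begin{cases}(u,u)&u\neq w\\ (e,e)&u=w\end{cases},\qquad \varphi^1(g)=\begin{cases}(g,t_E(g))& t_E(g)\ne w\\ (ge,e)& t_E(g)=w\end{cases}$$ (where $ge$ denotes the corresponding edge of $E_{R+}$) determine a regular extended path homomorphism $\varphi\colon S(E)\to S(E_{R+})$ that covariantly induces the inverse of $f_*$: $\varphi_*=(f_* )^{-1}$.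
   Context: A graph $E=(E^0,E^1,s_E,t_E)$ consists of arbitrary sets of vertices and edges with source and target maps. A vertex $v$ is regular if $s_E^{-1}(v)$ is finite and nonempty; $\mathrm{reg}(E)$ is the set of regular vertices. $\mathrm{FP}(E)$ is the set of finite paths (vertices, of length $0$, and sequences $e_1\ldots e_n$ of edges with $t_E(e_i)=s_E(e_{i+1})$); vertices act as units for concatenation. Unital reduction at a regular vertex $w$ not emitting a loop: $E_{R+}^0=E^0$, $E_{R+}^1=(E^1\setminus t_E^{-1}(w))\sqcup\{xy\mid x,y\in E^1,\ t_E(x)=w=s_E(y)\}$, where old edges keep their sources and targets and the (single) edge $xy$ has source $s_E(x)$ and target $t_E(y)$. $C^*(E)$ is the universal C*-algebra generated by mutually orthogonal projections $S_v$ ($v\in E^0$) and elements $S_e$ ($e\in E^1$) with $S_e^*S_{e'}=\delta_{e,e'}S_{t_E(e)}$, $S_{s_E(e)}S_e=S_e$, and $S_v=\sum_{e\in s_E^{-1}(v)}S_eS_e^*$ for $v\in\mathrm{reg}(E)$. For paths, $S_{e_1\ldots e_n}=S_{e_1}\cdots S_{e_n}$; put $S_{(\alpha,\beta)}=S_\alpha S_\beta^*$, $S_0=0$. It is known that $f_*$ in the claim is a $*$-isomorphism. The graph inverse semigroup is $S(E)=\{(\alpha,\beta)\in \mathrm{FP}(E)^2\mid t_E(\alpha)=t_E(\beta)\}\cup\{0\}$ with $(\alpha,\beta)(\gamma,\delta)=(\alpha\gamma',\delta)$ if $\gamma=\beta\gamma'$, $=(\alpha,\delta\beta')$ if $\beta=\gamma\beta'$,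 and $=0$ otherwise; $0$ is a zero element. It is an inverse semigroup with $(\alpha,\beta)^*=(\beta,\alpha)$ and natural order $s\le t\iff ss^*t=s$. An extended path homomorphism from $E$ to $F$ is a semigroup homomorphism $\varphi\colon S(E)\to S(F)$ with $\varphi(0)=0$. Maps $\varphi^0\colon E^0\to S(F)$, $\varphi^1\colon E^1\to S(F)$ determine $\varphi$ if $\varphi$ is the (necessarily unique) extended path homomorphism with $\varphi(v,v)=\varphi^0(v)$ and $\varphi(e,t_E(e))=\varphi^1(e)$. $\varphi$ is regular if whenever $u\in\mathrm{reg}(E)$, $0\ne t\in S(F)$ and $t\le\varphi(u,u)$, there exists $e\in s_E^{-1}(u)$ with $t\varphi(e,e)\neq0$. A regular $\varphi$ induces the $*$-homomorphism $\varphi_*\colon C^*(E)\to C^*(F)$, $S_v\mapsto S_{\varphi(v,v)}$, $S_e\mapsto S_{\varphi(e,t_E(e))}$. *)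

theory Defs
  imports
    Complex_Main
    "HOL-Library.Poly_Mapping"
    "HOL-Library.FuncSet"
    "HOL-Library.Sublist"
    "Graph_Theory.Arc_Walk"
begin

section \<open>Graphs and finite paths\<close>

text \<open>
  A graph is a \<^locale>\<open>wf_digraph\<close>: vertex and arc sets are arbitrary, and
  \<^const>\<open>tail\<close> and \<^const>\<open>head\<close> are the source and target maps.
\<close>

definition reg :: "('v, 'e) pre_digraph \<Rightarrow> 'v set" where
  "reg E = {v \<in> verts E. finite (out_arcs E v) \<and> out_arcs E v \<noteq> {}}"

text \<open>
  A path is stored with its source, so that the vertex \<open>v\<close> is the path \<open>(v, [])\<close>
  of length \<open>0\<close>.
\<close>

type_synonym ('v, 'e) path = "'v \<times> 'e list"

definition FP :: "('v, 'e) pre_digraph \<Rightarrow> ('v, 'e) path set" where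
  "FP E = {(u, p). \<exists>v. pre_digraph.awalk E u p v}"

definition path_tgt :: "('v, 'e) pre_digraph \<Rightarrow> ('v, 'e) path \<Rightarrow> 'v" where
  "path_tgt E \<alpha> = pre_digraph.awlast E (fst \<alpha>) (snd \<alpha>)"

definition vpath :: "'v \<Rightarrow> ('v, 'e) path" where
  "vpath v = (v, [])"

definition epath :: "('v, 'e) pre_digraph \<Rightarrow> 'e \<Rightarrow> ('v, 'e) path" where
  "epath E e = (tail E e, [e])"

text \<open>
  Unital reduction at \<open>w\<close>: \<open>Inl x\<close> is an old edge and \<open>Inr (x, y)\<close> is the new
  edge \<open>xy\<close>.
\<close>

definition unital_reduction ::
    "('v, 'e) pre_digraph \<Rightarrow> 'v \<Rightarrow> ('v, 'e + 'e \<times> 'e) pre_digraph" where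
  "unital_reduction E w =
    \<lparr> verts = verts E,
      arcs = Inl ` (arcs E - in_arcs E w) \<union> Inr ` (in_arcs E w \<times> out_arcs E w),
      tail = case_sum (tail E) (\<lambda>(x, y). tail E x),
      head = case_sum (head E) (\<lambda>(x, y). head E y) \<rparr>"


section \<open>Graph inverse semigroups and extended path homomorphisms\<close>

text \<open>\<^const>\<open>None\<close> is the zero element.\<close>

type_synonym ('v, 'e) gis = "(('v, 'e) path \<times> ('v, 'e) path) option"

definition gis_carrier :: "('v, 'e) pre_digraph \<Rightarrow> ('v, 'e) gis set" where
  "gis_carrier E =
    insert None {Some (\<alpha>, \<beta>) | \<alpha> \<beta>. \<alpha> \<in> FP E \<and> \<beta> \<in> FP E \<and> path_tgt E \<alpha> = path_tgt E \<beta>}"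

text \<open>
  \<open>path_prefix \<beta> \<gamma>\<close> says that \<open>\<gamma> = \<beta>\<gamma>'\<close> for a path \<open>\<gamma>'\<close>, and then
  \<open>path_extend \<alpha> \<beta> \<gamma>\<close> is the path \<open>\<alpha>\<gamma>'\<close>.
\<close>

definition path_prefix :: "('v, 'e) path \<Rightarrow> ('v, 'e) path \<Rightarrow> bool" where
  "path_prefix \<beta> \<gamma> \<longleftrightarrow> fst \<beta> = fst \<gamma> \<and> prefix (snd \<beta>) (snd \<gamma>)"

definition path_extend ::
    "('v, 'e) path \<Rightarrow> ('v, 'e) path \<Rightarrow> ('v, 'e) path \<Rightarrow> ('v, 'e) path" where
  "path_extend \<alpha> \<beta> \<gamma> = (fst \<alpha>, snd \<alpha> @ drop (length (snd \<beta>)) (snd \<gamma>))"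

fun gis_mult :: "('v, 'e) gis \<Rightarrow> ('v, 'e) gis \<Rightarrow> ('v, 'e) gis" where
  "gis_mult (Some (\<alpha>, \<beta>)) (Some (\<gamma>, \<delta>)) =
    (if path_prefix \<beta> \<gamma> then Some (path_extend \<alpha> \<beta> \<gamma>, \<delta>)
     else if path_prefix \<gamma> \<beta> then Some (\<alpha>, path_extend \<delta> \<gamma> \<beta>)
     else None)"
| "gis_mult None t = None"
| "gis_mult s None = None"

fun gis_star :: "('v, 'e) gis \<Rightarrow> ('v, 'e) gis" where
  "gis_star None = None"
| "gis_star (Some (\<alpha>, \<beta>)) = Some (\<beta>, \<alpha>)"

definition gis_le :: "('v, 'e) gis \<Rightarrow> ('v, 'e) gis \<Rightarrow> bool" where
  "gis_le s t \<longleftrightarrow> gis_mult (gis_mult s (gis_star s)) t = s"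

text \<open>Maps out of \<open>S(E)\<close> are kept extensional, so that equality is equality on \<open>S(E)\<close>.\<close>

definition ext_path_hom ::
    "('v, 'e) pre_digraph \<Rightarrow> ('u, 'f) pre_digraph \<Rightarrow> (('v, 'e) gis \<Rightarrow> ('u, 'f) gis) \<Rightarrow> bool" where
  "ext_path_hom E F \<phi> \<longleftrightarrow>
     \<phi> \<in> gis_carrier E \<rightarrow>\<^sub>E gis_carrier F \<and>
     (\<forall>s \<in> gis_carrier E. \<forall>t \<in> gis_carrier E. \<phi> (gis_mult s t) = gis_mult (\<phi> s) (\<phi> t)) \<and>
     \<phi> None = None"

definition extends_gens ::
    "('v, 'e) pre_digraph \<Rightarrow> ('v \<Rightarrow> ('u, 'f) gis) \<Rightarrow> ('e \<Rightarrow> ('u, 'f) gis) \<Rightarrow>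
     (('v, 'e) gis \<Rightarrow> ('u, 'f) gis) \<Rightarrow> bool" where
  "extends_gens E \<phi>0 \<phi>1 \<phi> \<longleftrightarrow>
     (\<forall>v \<in> verts E. \<phi> (Some (vpath v, vpath v)) = \<phi>0 v) \<and>
     (\<forall>e \<in> arcs E. \<phi> (Some (epath E e, vpath (head E e))) = \<phi>1 e)"

definition determines ::
    "('v, 'e) pre_digraph \<Rightarrow> ('u, 'f) pre_digraph \<Rightarrow>
     ('v \<Rightarrow> ('u, 'f) gis) \<Rightarrow> ('e \<Rightarrow> ('u, 'f) gis) \<Rightarrow>
     (('v, 'e) gis \<Rightarrow> ('u, 'f) gis) \<Rightarrow> bool" where
  "determines E F \<phi>0 \<phi>1 \<phi> \<longleftrightarrow>
     ext_path_hom E F \<phi> \<and> extends_gens E \<phi>0 \<phi>1 \<phi> \<and>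
     (\<forall>\<psi>. ext_path_hom E F \<psi> \<and> extends_gens E \<phi>0 \<phi>1 \<psi> \<longrightarrow> \<psi> = \<phi>)"

definition regular_hom ::
    "('v, 'e) pre_digraph \<Rightarrow> ('u, 'f) pre_digraph \<Rightarrow> (('v, 'e) gis \<Rightarrow> ('u, 'f) gis) \<Rightarrow> bool" where
  "regular_hom E F \<phi> \<longleftrightarrow>
     (\<forall>u \<in> reg E. \<forall>t \<in> gis_carrier F.
        t \<noteq> None \<and> gis_le t (\<phi> (Some (vpath u, vpath u))) \<longrightarrow>
        (\<exists>e \<in> out_arcs E u. gis_mult t (\<phi> (Some (epath E e, epath E e))) \<noteq> None))"


section \<open>Free \<open>*\<close>-algebras\<close>

text \<open>
  Letters are pairs \<open>(g, b)\<close> of a generator \<open>g\<close> and a flag \<open>b\<close>, where \<open>(g, True)\<close>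
  stands for \<open>g\<^sup>*\<close>. Words form a monoid under concatenation, so that the type
  \<open>'g sword \<Rightarrow>\<^sub>0 complex\<close> of finitely supported functions with its convolution
  product is the free unital \<open>*\<close>-algebra on \<open>'g\<close>.
\<close>

datatype 'g sword = SWord (letters: "('g \<times> bool) list")

instantiation sword :: (type) monoid_add
begin

definition zero_sword :: "'a sword" where
  "0 = SWord []"

definition plus_sword :: "'a sword \<Rightarrow> 'a sword \<Rightarrow> 'a sword" where
  "u + v = SWord (letters u @ letters v)"

instance
  by standard (simp_all add: zero_sword_def plus_sword_def)

end

definition sword_adj :: "'g sword \<Rightarrow> 'g sword" where
  "sword_adj u = SWord (rev (map (\<lambda>(g, b). (g, \<not> b)) (letters u)))"

type_synonym 'g free_alg = "'g sword \<Rightarrow>\<^sub>0 complex"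

definition gen :: "'g \<Rightarrow> 'g free_alg" where
  "gen g = Poly_Mapping.single (SWord [(g, False)]) 1"

definition fscale :: "complex \<Rightarrow> 'g free_alg \<Rightarrow> 'g free_alg" where
  "fscale c x = Poly_Mapping.map ((*) c) x"

definition fstar :: "'g free_alg \<Rightarrow> 'g free_alg" where
  "fstar x = Poly_Mapping.map_key sword_adj (Poly_Mapping.map cnj x)"

text \<open>
  The free, not necessarily unital, \<open>*\<close>-algebra on the set \<open>G\<close>: the empty word is
  excluded.
\<close>

definition free_star_alg :: "'g set \<Rightarrow> 'g free_alg set" where
  "free_star_alg G =
    {x. \<forall>u \<in> Poly_Mapping.keys x. letters u \<noteq> [] \<and> fst ` set (letters u) \<subseteq> G}"


section \<open>Universal C*-algebras\<close>

record 'a cstar =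
  cs_carrier :: "'a set"
  cs_add :: "'a \<Rightarrow> 'a \<Rightarrow> 'a"
  cs_mult :: "'a \<Rightarrow> 'a \<Rightarrow> 'a"
  cs_scale :: "complex \<Rightarrow> 'a \<Rightarrow> 'a"
  cs_star :: "'a \<Rightarrow> 'a"
  cs_norm :: "'a \<Rightarrow> real"

definition star_hom :: "'a cstar \<Rightarrow> 'b cstar \<Rightarrow> ('a \<Rightarrow> 'b) \<Rightarrow> bool" where
  "star_hom A B f \<longleftrightarrow>
     f \<in> cs_carrier A \<rightarrow> cs_carrier B \<and>
     (\<forall>x \<in> cs_carrier A. \<forall>y \<in> cs_carrier A.
        f (cs_add A x y) = cs_add B (f x) (f y) \<and>
        f (cs_mult A x y) = cs_mult B (f x) (f y)) \<and>
     (\<forall>x \<in> cs_carrier A. (\<forall>c. f (cs_scale A c x) = cs_scale B c (f x)) \<and>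
        f (cs_star A x) = cs_star B (f x))"

definition star_iso :: "'a cstar \<Rightarrow> 'b cstar \<Rightarrow> ('a \<Rightarrow> 'b) \<Rightarrow> bool" where
  "star_iso A B f \<longleftrightarrow> star_hom A B f \<and> bij_betw f (cs_carrier A) (cs_carrier B)"

text \<open>
  The C*-seminorms on the free \<open>*\<close>-algebra on \<open>G\<close> that vanish on the set \<open>R\<close>. These
  are exactly the seminorms obtained from \<open>G\<close>-indexed families in C*-algebras satisfying
  the relations \<open>r = 0\<close> for \<open>r \<in> R\<close>.
\<close>

definition cstar_seminorm :: "'g set \<Rightarrow> 'g free_alg set \<Rightarrow> ('g free_alg \<Rightarrow> real) \<Rightarrow> bool" where
  "cstar_seminorm G R p \<longleftrightarrow>
     (\<forall>x \<in> free_star_alg G. \<forall>y \<in> free_star_alg G.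
        p (x + y) \<le> p x + p y \<and> p (x * y) \<le> p x * p y) \<and>
     (\<forall>x \<in> free_star_alg G. 0 \<le> p x \<and> (\<forall>c. p (fscale c x) = cmod c * p x) \<and>
        p (fstar x * x) = (p x)\<^sup>2) \<and>
     (\<forall>r \<in> R. p r = 0)"

text \<open>
  The supremum is only meaningful when these seminorms are bounded at each element,
  which is the usual condition for the universal C*-algebra to exist. For the
  Cuntz-Krieger relations below it holds, as every generator is then a partial isometry
  and so has seminorm at most \<open>1\<close>.
\<close>

definition univ_seminorm :: "'g set \<Rightarrow> 'g free_alg set \<Rightarrow> 'g free_alg \<Rightarrow> real" where
  "univ_seminorm G R x = Sup {p x | p. cstar_seminorm G R p}"

text \<open>
  The universal C*-algebra is the Hausdorff completion of the free \<open>*\<close>-algebra for the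
  universal seminorm, realised as Cauchy sequences modulo null sequences.
\<close>

definition univ_cauchy :: "'g set \<Rightarrow> 'g free_alg set \<Rightarrow> (nat \<Rightarrow> 'g free_alg) set" where
  "univ_cauchy G R =
    {x. range x \<subseteq> free_star_alg G \<and>
        (\<forall>\<epsilon>>0. \<exists>N. \<forall>m\<ge>N. \<forall>n\<ge>N. univ_seminorm G R (x m - x n) < \<epsilon>)}"

definition univ_rel ::
    "'g set \<Rightarrow> 'g free_alg set \<Rightarrow> ((nat \<Rightarrow> 'g free_alg) \<times> (nat \<Rightarrow> 'g free_alg)) set" where
  "univ_rel G R =
    {(x, y). x \<in> univ_cauchy G R \<and> y \<in> univ_cauchy G R \<and>
             (\<lambda>n. univ_seminorm G R (x n - y n)) \<longlonglongrightarrow> 0}"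

definition univ_class ::
    "'g set \<Rightarrow> 'g free_alg set \<Rightarrow> (nat \<Rightarrow> 'g free_alg) \<Rightarrow> (nat \<Rightarrow> 'g free_alg) set" where
  "univ_class G R x = univ_rel G R `` {x}"

definition univ_cstar ::
    "'g set \<Rightarrow> 'g free_alg set \<Rightarrow> (nat \<Rightarrow> 'g free_alg) set cstar" where
  "univ_cstar G R =
    \<lparr> cs_carrier = univ_cauchy G R // univ_rel G R,
      cs_add = (\<lambda>X Y. \<Union>x\<in>X. \<Union>y\<in>Y. univ_class G R (\<lambda>n. x n + y n)),
      cs_mult = (\<lambda>X Y. \<Union>x\<in>X. \<Union>y\<in>Y. univ_class G R (\<lambda>n. x n * y n)),
      cs_scale = (\<lambda>c X. \<Union>x\<in>X. univ_class G R (\<lambda>n. fscale c (x n))),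
      cs_star = (\<lambda>X. \<Union>x\<in>X. univ_class G R (\<lambda>n. fstar (x n))),
      cs_norm = (\<lambda>X. the_elem ((\<lambda>x. lim (\<lambda>n. univ_seminorm G R (x n))) ` X)) \<rparr>"

definition univ_gen ::
    "'g set \<Rightarrow> 'g free_alg set \<Rightarrow> 'g \<Rightarrow> (nat \<Rightarrow> 'g free_alg) set" where
  "univ_gen G R g = univ_class G R (\<lambda>n. gen g)"


section \<open>Graph C*-algebras\<close>

definition ck_gens :: "('v, 'e) pre_digraph \<Rightarrow> ('v + 'e) set" where
  "ck_gens E = Inl ` verts E \<union> Inr ` arcs E"

definition ck_rels :: "('v, 'e) pre_digraph \<Rightarrow> ('v + 'e) free_alg set" where
  "ck_rels E =
    {gen (Inl v) * gen (Inl v) - gen (Inl v) | v. v \<in> verts E} \<union>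
    {fstar (gen (Inl v)) - gen (Inl v) | v. v \<in> verts E} \<union>
    {gen (Inl v) * gen (Inl v') | v v'. v \<in> verts E \<and> v' \<in> verts E \<and> v \<noteq> v'} \<union>
    {fstar (gen (Inr e)) * gen (Inr e) - gen (Inl (head E e)) | e. e \<in> arcs E} \<union>
    {fstar (gen (Inr e)) * gen (Inr e') | e e'. e \<in> arcs E \<and> e' \<in> arcs E \<and> e \<noteq> e'} \<union>
    {gen (Inl (tail E e)) * gen (Inr e) - gen (Inr e) | e. e \<in> arcs E} \<union>
    {gen (Inl v) - (\<Sum>e\<in>out_arcs E v. gen (Inr e) * fstar (gen (Inr e))) | v. v \<in> reg E}"

type_synonym ('v, 'e) gcs = "(nat \<Rightarrow> ('v + 'e) free_alg) set"

definition graph_cstar :: "('v, 'e) pre_digraph \<Rightarrow> ('v, 'e) gcs cstar" where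
  "graph_cstar E = univ_cstar (ck_gens E) (ck_rels E)"

definition S_vert :: "('v, 'e) pre_digraph \<Rightarrow> 'v \<Rightarrow> ('v, 'e) gcs" where
  "S_vert E v = univ_gen (ck_gens E) (ck_rels E) (Inl v)"

definition S_edge :: "('v, 'e) pre_digraph \<Rightarrow> 'e \<Rightarrow> ('v, 'e) gcs" where
  "S_edge E e = univ_gen (ck_gens E) (ck_rels E) (Inr e)"

fun S_path :: "('v, 'e) pre_digraph \<Rightarrow> ('v, 'e) path \<Rightarrow> ('v, 'e) gcs" where
  "S_path E (u, []) = S_vert E u"
| "S_path E (u, [e]) = S_edge E e"
| "S_path E (u, e # e' # p) = cs_mult (graph_cstar E) (S_edge E e) (S_path E (head E e, e' # p))"

definition S_zero :: "('v, 'e) pre_digraph \<Rightarrow> ('v, 'e) gcs" where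
  "S_zero E = univ_class (ck_gens E) (ck_rels E) (\<lambda>n. 0)"

fun S_gis :: "('v, 'e) pre_digraph \<Rightarrow> ('v, 'e) gis \<Rightarrow> ('v, 'e) gcs" where
  "S_gis E None = S_zero E"
| "S_gis E (Some (\<alpha>, \<beta>)) =
     cs_mult (graph_cstar E) (S_path E \<alpha>) (cs_star (graph_cstar E) (S_path E \<beta>))"

text \<open>Extensionality makes the map \<open>\<psi>\<close> with the following property unique.\<close>

definition induces ::
    "('v, 'e) pre_digraph \<Rightarrow> ('u, 'f) pre_digraph \<Rightarrow> (('v, 'e) gis \<Rightarrow> ('u, 'f) gis) \<Rightarrow>
     (('v, 'e) gcs \<Rightarrow> ('u, 'f) gcs) \<Rightarrow> bool" where
  "induces E F \<phi> \<psi> \<longleftrightarrow>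
     \<psi> \<in> extensional (cs_carrier (graph_cstar E)) \<and>
     star_hom (graph_cstar E) (graph_cstar F) \<psi> \<and>
     (\<forall>v \<in> verts E. \<psi> (S_vert E v) = S_gis F (\<phi> (Some (vpath v, vpath v)))) \<and>
     (\<forall>e \<in> arcs E. \<psi> (S_edge E e) = S_gis F (\<phi> (Some (epath E e, vpath (head E e)))))"

definition induced_hom ::
    "('v, 'e) pre_digraph \<Rightarrow> ('u, 'f) pre_digraph \<Rightarrow> (('v, 'e) gis \<Rightarrow> ('u, 'f) gis) \<Rightarrow>
     ('v, 'e) gcs \<Rightarrow> ('u, 'f) gcs" where
  "induced_hom E F \<phi> = (THE \<psi>. induces E F \<phi> \<psi>)"

end

theory Submission
  imports Defs "HOL-Library.Function_Algebras"
begin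

text \<open>
  A path of \<open>E\<close> ending in \<open>w\<close> is first prolonged by \<open>e\<close>, the only edge leaving \<open>w\<close>; in a path
  not ending in \<open>w\<close> every edge \<open>g\<close> into \<open>w\<close> is followed by \<open>e\<close>, so that the pair \<open>ge\<close> can be
  read as one edge of \<open>E\<^sub>R\<^sub>+\<close>. Doing this to both components defines \<open>\<phi>\<close>. Its uniqueness
  comes from the uniqueness of inverses in \<open>S(E\<^sub>R\<^sub>+)\<close>, which makes homomorphisms preserve the
  involution.

  The map \<open>f\<^sub>*\<close> sends \<open>S\<^bsub>\<phi>(v,v)\<^esub>\<close> to \<open>S\<^sub>v\<close> and \<open>S\<^bsub>\<phi>(g,t(g))\<^esub>\<close> to \<open>S\<^sub>g\<close>, by \<open>S\<^sub>w = S\<^sub>eS\<^sub>e\<^sup>*\<close>, so its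
  inverse is induced by \<open>\<phi>\<close>. That nothing else is induced by \<open>\<phi>\<close> requires star homomorphisms to
  be contractive: if \<open>h\<close> is self-adjoint with \<open>\<parallel>h\<parallel> < 1\<close>, then \<open>h + i sqrt (1 - h\<^sup>2)\<close> is unitary with
  real part \<open>h\<close>, so every C*-seminorm of \<open>h\<close> is at most \<open>1\<close>.
\<close>

section \<open>Free star algebras\<close>

text \<open>The values at w are forced: an edge g into w survives in \<open>ER\<close> only inside
  the edge ge, so S_g has to become S_(ge) S_e^*, whose initial projection is S_e S_e^*. In S(E_R+)
  the elements (w,w) and (e,e) differ, although S_w = S_e S_e^* holds in the algebra; the
  correspondence is exact only after passing to C*-algebras. As \<open>star_hom\<close> carries no
  continuity, agreement on generators reaches only the image of the free algebra, and density alone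
  does not extend it. The algebras have no unit in general, and the quotient is a record and not a
  ring type. Therefore the contractivity argument lives on Cauchy sequences, where the norm pulled
  back along the homomorphism is a second C*-seminorm. Square roots are diagonal sequences of
  approximants: they solve their equation up to a null sequence, which is an exact solution for that
  second seminorm.\<close>

lemma poly_mapping_add_single_induct [case_names zero add]:
  fixes x :: "'a \<Rightarrow>\<^sub>0 'b::monoid_add"
  assumes "P 0"
    and "\<And>x u c. u \<notin> Poly_Mapping.keys x \<Longrightarrow> c \<noteq> 0 \<Longrightarrow> P x \<Longrightarrow> P (Poly_Mapping.single u c + x)"
  shows "P x"
proof (induction x rule: update_induct)
  case (update f a b)
  have "Poly_Mapping.update a b f = Poly_Mapping.single a b + f"
    using update.hyps
    by (intro poly_mapping_eqI)
      (auto simp: lookup_update lookup_add lookup_single when_def in_keys_iff)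
  then show ?case using assms(2) update by simp
qed fact

lemma lookup_fscale [simp]: "Poly_Mapping.lookup (fscale c x) k = c * Poly_Mapping.lookup x k"
  by (simp add: fscale_def Poly_Mapping.map.rep_eq when_def)

lemma sword_adj_adj [simp]: "sword_adj (sword_adj u) = u"
  by (cases u) (auto simp: sword_adj_def rev_map comp_def case_prod_beta)

lemma inj_sword_adj: "inj sword_adj"
  by (metis injI sword_adj_adj)

lemma sword_adj_plus: "sword_adj (u + v) = sword_adj v + sword_adj u"
  by (simp add: sword_adj_def plus_sword_def)

lemma lookup_fstar [simp]:
  "Poly_Mapping.lookup (fstar x) u = cnj (Poly_Mapping.lookup x (sword_adj u))"
  by (simp add: fstar_def map_key.rep_eq inj_sword_adj Poly_Mapping.map.rep_eq when_def)

lemma fscale_add_right: "fscale c (x + y) = fscale c x + fscale c y"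
  and fscale_add_left: "fscale (c + d) x = fscale c x + fscale d x"
  and fscale_fscale: "fscale c (fscale d x) = fscale (c * d) x"
  and fscale_one: "fscale 1 x = x"
  and fstar_add: "fstar (x + y) = fstar x + fstar y"
  and fstar_fscale: "fstar (fscale c x) = fscale (cnj c) (fstar x)"
  and fstar_fstar: "fstar (fstar x) = x"
  by (auto intro!: poly_mapping_eqI simp: lookup_add algebra_simps)

lemma fscale_single: "fscale c (Poly_Mapping.single u d) = Poly_Mapping.single u (c * d)"
  by (rule poly_mapping_eqI) (simp add: lookup_single when_def)

text \<open>\<open>single 0 c\<close> is c times the empty word, the unit of the ambient unital
  algebra. Scalars thus become ring elements, and \<open>fscale_mult_left\<close> is
  associativity.\<close>

lemma fscale_eq_single_mult: "fscale c x = Poly_Mapping.single 0 c * x"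
proof (induction x rule: poly_mapping_add_single_induct)
  case zero
  show ?case by (rule poly_mapping_eqI) simp
next
  case (add x u d)
  then show ?case
    by (simp add: fscale_add_right distrib_left fscale_single mult_single)
qed

lemma fscale_mult_left: "fscale c x * y = fscale c (x * y)"
  by (simp add: fscale_eq_single_mult mult.assoc)

lemma fstar_single: "fstar (Poly_Mapping.single u c) = Poly_Mapping.single (sword_adj u) (cnj c)"
  by (rule poly_mapping_eqI) (auto simp: lookup_single when_def)

lemma fscale_mult_right: "x * fscale c y = fscale c (x * y)"
proof (induction x rule: poly_mapping_add_single_induct)
  case (add x u d)
  \<comment> \<open>The scalar can pass the word \<open>u\<close> because the empty word is neutral
    and complex multiplication commutes.\<close>
  have "Poly_Mapping.single u d * fscale c y = fscale c (Poly_Mapping.single u d * y)"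
    by (simp add: fscale_eq_single_mult mult.assoc[symmetric] mult_single mult.commute)
  with add show ?case by (simp add: distrib_right fscale_add_right)
qed (simp add: fscale_eq_single_mult)

lemma fstar_mult: "fstar (x * y) = fstar y * fstar x"
proof (induction x rule: poly_mapping_add_single_induct)
  case zero
  have "fstar 0 = (0 :: 'a free_alg)" by (rule poly_mapping_eqI) simp
  then show ?case by simp
next
  case (add x u c)
  have "fstar (Poly_Mapping.single u c * y) = fstar y * fstar (Poly_Mapping.single u c)"
  proof (induction y rule: poly_mapping_add_single_induct)
    case zero
    have "fstar 0 = (0 :: 'a free_alg)" by (rule poly_mapping_eqI) simp
    then show ?case by simp
  next
    case (add y v d)
    then show ?case
      by (simp add: distrib_left distrib_right fstar_add mult_single fstar_single sword_adj_plus
          mult.commute)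
  qed
  with add show ?case by (simp add: distrib_left distrib_right fstar_add)
qed

lemma free_star_alg_add: "x \<in> free_star_alg G \<Longrightarrow> y \<in> free_star_alg G \<Longrightarrow> x + y \<in> free_star_alg G"
  unfolding free_star_alg_def using Poly_Mapping.keys_add[of x y] by blast

lemma free_star_alg_mult:
  assumes "x \<in> free_star_alg G" "y \<in> free_star_alg G"
  shows "x * y \<in> free_star_alg G"
  unfolding free_star_alg_def
proof (clarify, intro conjI)
  fix u assume "u \<in> Poly_Mapping.keys (x * y)"
  then obtain a b where "a \<in> Poly_Mapping.keys x" "b \<in> Poly_Mapping.keys y" "u = a + b"
    using keys_mult[of x y] by blast
  with assms show "letters u \<noteq> []" "fst ` set (letters u) \<subseteq> G"
    unfolding free_star_alg_def by (auto simp: plus_sword_def)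
qed

lemma free_star_alg_fscale: "x \<in> free_star_alg G \<Longrightarrow> fscale c x \<in> free_star_alg G"
  unfolding free_star_alg_def by (auto simp: in_keys_iff)

lemma free_star_alg_fstar:
  assumes "x \<in> free_star_alg G"
  shows "fstar x \<in> free_star_alg G"
  unfolding free_star_alg_def
proof (clarify, intro conjI)
  fix u assume "u \<in> Poly_Mapping.keys (fstar x)"
  then have "sword_adj u \<in> Poly_Mapping.keys x" by (simp add: in_keys_iff)
  with assms have "letters (sword_adj u) \<noteq> []" "fst ` set (letters (sword_adj u)) \<subseteq> G"
    unfolding free_star_alg_def by blast+
  then show "letters u \<noteq> []" "fst ` set (letters u) \<subseteq> G"
    by (auto simp: sword_adj_def image_image case_prod_beta)
qed

lemma free_star_alg_zero: "0 \<in> free_star_alg G"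
  by (simp add: free_star_alg_def)

lemma free_star_alg_gen: "g \<in> G \<Longrightarrow> gen g \<in> free_star_alg G"
  by (simp add: free_star_alg_def gen_def)

text \<open>Nonempty words are products of letters, and a starred letter is \<open>fstar\<close> of
  a generator, so sums of multiples of such products exhaust the algebra. The empty word never
  arises, which keeps the unit out.\<close>

lemma free_star_alg_induct [consumes 1, case_names zero gen add mult scale star]:
  assumes "x \<in> free_star_alg G"
    and zero: "P 0"
    and gen: "\<And>g. g \<in> G \<Longrightarrow> P (gen g)"
    and add: "\<And>x y. x \<in> free_star_alg G \<Longrightarrow> y \<in> free_star_alg G \<Longrightarrow> P x \<Longrightarrow> P y \<Longrightarrow> P (x + y)"
    and mult: "\<And>x y. x \<in> free_star_alg G \<Longrightarrow> y \<in> free_star_alg G \<Longrightarrow> P x \<Longrightarrow> P y \<Longrightarrow> P (x * y)"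
    and scale: "\<And>x c. x \<in> free_star_alg G \<Longrightarrow> P x \<Longrightarrow> P (fscale c x)"
    and star: "\<And>x. x \<in> free_star_alg G \<Longrightarrow> P x \<Longrightarrow> P (fstar x)"
  shows "P x"
proof -
  have letter: "Poly_Mapping.single (SWord [l]) 1 \<in> free_star_alg G \<and>
      P (Poly_Mapping.single (SWord [l]) 1)" if "fst l \<in> G" for l
  proof (cases l)
    case (Pair g b)
    with that have g: "gen g \<in> free_star_alg G" "P (gen g)"
      by (auto simp: free_star_alg_gen gen)
    show ?thesis
    proof (cases b)
      case True
      have "Poly_Mapping.single (SWord [l]) 1 = fstar (gen g)"
        by (simp add: gen_def fstar_single sword_adj_def Pair True)
      with g star free_star_alg_fstar show ?thesis by metis
    next
      case False
      with g show ?thesis by (simp add: gen_def Pair)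
    qed
  qed
  have word: "Poly_Mapping.single (SWord ls) 1 \<in> free_star_alg G \<and> P (Poly_Mapping.single (SWord ls) 1)"
    if "ls \<noteq> []" "fst ` set ls \<subseteq> G" for ls
    using that
  proof (induction ls rule: list_nonempty_induct)
    case (single l)
    then show ?case using letter by simp
  next
    case (cons l ls)
    have "Poly_Mapping.single (SWord (l # ls)) (1::complex)
        = Poly_Mapping.single (SWord [l]) 1 * Poly_Mapping.single (SWord ls) 1"
      by (simp add: mult_single plus_sword_def)
    with cons letter[of l] mult free_star_alg_mult show ?case
      by (metis image_subset_iff list.set_intros)
  qed
  show ?thesis using assms(1)
  proof (induction x rule: poly_mapping_add_single_induct)
    case zero
    show ?case by fact
  next
    case (add x u c)
    have keys: "Poly_Mapping.keys (Poly_Mapping.single u c + x) = insert u (Poly_Mapping.keys x)"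
      using add.hyps by (auto simp: in_keys_iff lookup_add lookup_single when_def split: if_splits)
    with add.prems have x: "x \<in> free_star_alg G" and u: "letters u \<noteq> []" "fst ` set (letters u) \<subseteq> G"
      unfolding free_star_alg_def by auto
    have "Poly_Mapping.single u c = fscale c (Poly_Mapping.single (SWord (letters u)) 1)"
      by (simp add: fscale_single)
    then show ?case
      using word[OF u] x add.IH[OF x] assms(4) scale free_star_alg_fscale by metis
  qed
qed

section \<open>C*-seminorms\<close>

text \<open>Instantiated with the free algebra and with the Cauchy sequences in it. The laws hold on
  the whole type and only closure refers to \<open>C\<close>, so algebraic rewriting produces no
  membership goals.\<close>

locale star_algebra =
  fixes C :: "'a::ring set" and sc :: "complex \<Rightarrow> 'a \<Rightarrow> 'a" and st :: "'a \<Rightarrow> 'a"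
  assumes zero_closed: "0 \<in> C"
    and add_closed: "x \<in> C \<Longrightarrow> y \<in> C \<Longrightarrow> x + y \<in> C"
    and mult_closed: "x \<in> C \<Longrightarrow> y \<in> C \<Longrightarrow> x * y \<in> C"
    and sc_closed: "x \<in> C \<Longrightarrow> sc c x \<in> C"
    and st_closed: "x \<in> C \<Longrightarrow> st x \<in> C"
    and sc_add_right: "sc c (x + y) = sc c x + sc c y"
    and sc_add_left: "sc (c + d) x = sc c x + sc d x"
    and sc_sc: "sc c (sc d x) = sc (c * d) x"
    and sc_one: "sc 1 x = x"
    and sc_mult_left: "sc c x * y = sc c (x * y)"
    and sc_mult_right: "x * sc c y = sc c (x * y)"
    and st_add: "st (x + y) = st x + st y"
    and st_sc: "st (sc c x) = sc (cnj c) (st x)"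
    and st_mult: "st (x * y) = st y * st x"
    and st_st: "st (st x) = x"
begin

lemma sc_zero_left: "sc 0 x = 0"
  using sc_add_left[of 0 0 x] by simp

lemma sc_minus_left: "sc (- c) x = - sc c x"
  using sc_add_left[of c "- c" x] by (simp add: sc_zero_left add_eq_0_iff)

lemma sc_zero_right: "sc c 0 = 0"
  using sc_add_right[of c 0 0] by simp

lemma sc_minus_right: "sc c (- x) = - sc c x"
  using sc_add_right[of c x "- x"] by (simp add: sc_zero_right add_eq_0_iff)

lemma sc_diff_right: "sc c (x - y) = sc c x - sc c y"
  using sc_add_right[of c x "- y"] by (simp add: sc_minus_right)

lemma st_zero: "st 0 = 0"
  using st_add[of 0 0] by simp

lemma st_minus: "st (- x) = - st x"
  using st_add[of x "- x"] by (simp add: st_zero add_eq_0_iff)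

lemma st_diff: "st (x - y) = st x - st y"
  using st_add[of x "- y"] by (simp add: st_minus)

lemma minus_closed: "x \<in> C \<Longrightarrow> - x \<in> C"
  using sc_closed[of x "-1"] by (simp add: sc_minus_left sc_one)

lemma diff_closed: "x \<in> C \<Longrightarrow> y \<in> C \<Longrightarrow> x - y \<in> C"
  using add_closed[of x "- y"] minus_closed by simp

text \<open>
  For a small self-adjoint \<open>a\<close> this iteration converges to the solution \<open>b\<close> of
  \<open>2b - b\<^sup>2 = a\<close>, that is, to \<open>1 - sqrt (1 - a)\<close>.
\<close>

primrec sqrt_iter :: "nat \<Rightarrow> 'a \<Rightarrow> 'a" where
  "sqrt_iter 0 a = 0"
| "sqrt_iter (Suc k) a = sc (1/2) (a + sqrt_iter k a * sqrt_iter k a)"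

lemma sqrt_iter_closed: "a \<in> C \<Longrightarrow> sqrt_iter k a \<in> C"
  by (induction k) (auto intro: zero_closed sc_closed add_closed mult_closed)

lemma st_sqrt_iter: "st a = a \<Longrightarrow> st (sqrt_iter k a) = sqrt_iter k a"
  by (induction k) (auto simp: st_zero st_sc st_add st_mult)

text \<open>The iterates are polynomials in \<open>a\<close>. With \<open>a = h * h\<close> and
  \<open>y = h\<close> this makes the square root commute with h.\<close>

lemma sqrt_iter_commute: "y * a = a * y \<Longrightarrow> y * sqrt_iter k a = sqrt_iter k a * y"
proof (induction k)
  case (Suc k)
  have "y * (sqrt_iter k a * sqrt_iter k a) = sqrt_iter k a * sqrt_iter k a * y"
    using Suc by (metis mult.assoc)
  with Suc show ?case by (simp add: sc_mult_left sc_mult_right distrib_left distrib_right)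
qed simp

end

section \<open>C*-seminorms and the unitary argument\<close>

locale cstar_seminormed_algebra = star_algebra C sc st
  for C :: "'a::ring set" and sc st +
  fixes p :: "'a \<Rightarrow> real"
  assumes p_add: "x \<in> C \<Longrightarrow> y \<in> C \<Longrightarrow> p (x + y) \<le> p x + p y"
    and p_mult: "x \<in> C \<Longrightarrow> y \<in> C \<Longrightarrow> p (x * y) \<le> p x * p y"
    and p_nonneg: "x \<in> C \<Longrightarrow> 0 \<le> p x"
    and p_sc: "x \<in> C \<Longrightarrow> p (sc c x) = cmod c * p x"
    and p_cstar: "x \<in> C \<Longrightarrow> p (st x * x) = (p x)\<^sup>2"
begin

lemma p_zero: "p 0 = 0"
  using p_sc[OF zero_closed, of 0] by (simp add: sc_zero_left)

lemma p_minus: "x \<in> C \<Longrightarrow> p (- x) = p x"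
  using p_sc[of x "-1"] by (simp add: sc_minus_left sc_one)

lemma p_diff: "x \<in> C \<Longrightarrow> y \<in> C \<Longrightarrow> p (x - y) \<le> p x + p y"
  using p_add[of x "- y"] p_minus[of y] minus_closed[of y] by simp

lemma p_diff_commute: "x \<in> C \<Longrightarrow> y \<in> C \<Longrightarrow> p (x - y) = p (y - x)"
  using p_minus[of "x - y"] diff_closed[of x y] by simp

lemma p_diff_triangle: "x \<in> C \<Longrightarrow> y \<in> C \<Longrightarrow> z \<in> C \<Longrightarrow> p (x - z) \<le> p (x - y) + p (y - z)"
  using p_add[of "x - y" "y - z"] diff_closed by simp

lemma abs_p_diff: "x \<in> C \<Longrightarrow> y \<in> C \<Longrightarrow> \<bar>p x - p y\<bar> \<le> p (x - y)"
  using p_add[of "x - y" y] p_add[of "y - x" x] diff_closed p_diff_commute[of x y] by fastforce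

lemma p_eq_if_diff_null: "x \<in> C \<Longrightarrow> y \<in> C \<Longrightarrow> p (x - y) = 0 \<Longrightarrow> p x = p y"
  using abs_p_diff[of x y] by simp

lemma p_mult_null: "x \<in> C \<Longrightarrow> y \<in> C \<Longrightarrow> p x = 0 \<or> p y = 0 \<Longrightarrow> p (x * y) = 0"
  using p_mult[of x y] p_nonneg[OF mult_closed, of x y] by auto

lemma p_add_null: "x \<in> C \<Longrightarrow> y \<in> C \<Longrightarrow> p x = 0 \<Longrightarrow> p y = 0 \<Longrightarrow> p (x + y) = 0"
  using p_add[of x y] p_nonneg[OF add_closed, of x y] by simp

lemma p_st: assumes x: "x \<in> C" shows "p (st x) = p x"
proof -
  have le: "p y \<le> p (st y)" if y: "y \<in> C" for y
  proof (cases "p y = 0")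
    case True
    then show ?thesis using p_nonneg[OF st_closed[OF y]] by simp
  next
    case False
    have "p y * p y \<le> p (st y) * p y"
      using p_cstar[OF y] p_mult[OF st_closed[OF y] y] by (simp add: power2_eq_square)
    with False p_nonneg[OF y] show ?thesis by simp
  qed
  show ?thesis using le[OF x] le[OF st_closed[OF x]] by (simp add: st_st)
qed

text \<open>
  The element \<open>u = h + i(1 - b)\<close> of the unitisation is unitary and \<open>h = (u + u\<^sup>*)/2\<close>. Only
  its left multiplication operator on \<open>C\<close> is used.
\<close>

lemma p_le_one_if_sqrt_complement:
  assumes C: "h \<in> C" "b \<in> C"
    and sa: "st h = h" "st b = b"
    and comm: "h * b = b * h"
    and null: "p (b + b - b * b - h * h) = 0"
  shows "p h \<le> 1"
proof -
  \<comment> \<open>\<open>k\<close> is h^2 + (1 - b)^2 - 1, the defect of unitarity, with the units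
    cancelled so that it lies in \<open>C\<close>.\<close>
  define k where "k = h * h + b * b - b - b"
  have k: "k \<in> C" "p k = 0"
  proof -
    show "k \<in> C" unfolding k_def by (intro diff_closed add_closed mult_closed C)
    have "k = - (b + b - b * b - h * h)" by (simp add: k_def algebra_simps)
    then show "p k = 0"
      using null p_minus[of "b + b - b * b - h * h"] C
      by (simp add: diff_closed add_closed mult_closed)
  qed
  \<comment> \<open>Left multiplication by h + c(1 - b), to be used with c = \<i> and c = -
    \<i>.\<close>
  define U where "U c z = sc c z + (h * z - sc c (b * z))" for c z
  have U_closed: "U c z \<in> C" if "z \<in> C" for c z
    using that C unfolding U_def by (intro diff_closed add_closed mult_closed sc_closed)
  have U_isom: "p (U c z) = p z" if z: "z \<in> C" and c: "cnj c = - c" "c * c = - 1" for c z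
  proof -
    have comm': "h * (b * y) = b * (h * y)" for y
      using comm by (metis mult.assoc)
    \<comment> \<open>The mixed terms cancel because \<open>c\<close> is imaginary and h commutes
      with b; what remains is st z (1 + k) z.\<close>
    have "st (U c z) * U c z = st z * z + st z * (k * z)"
      using sa c comm comm'
      by (simp add: U_def k_def st_add st_diff st_sc st_mult algebra_simps sc_mult_left
          sc_mult_right sc_sc sc_diff_right sc_add_right sc_minus_left sc_minus_right sc_one)
    moreover have "p (st z * (k * z)) = 0"
      using z k by (simp add: p_mult_null mult_closed st_closed)
    ultimately have "p (st (U c z) * U c z) = p (st z * z)"
      using z k U_closed[OF z]
      by (intro p_eq_if_diff_null) (auto intro!: add_closed mult_closed st_closed)
    then show ?thesis
      using z U_closed[OF z] by (simp add: p_cstar p_nonneg power2_eq_iff_nonneg)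
  qed
  \<comment> \<open>The two unitaries add up to 2h. Evaluated at h in place of the missing unit,
    this gives 2 p(h^2) <= 2 p(h), where p(h^2) = p(h)^2.\<close>
  have "U \<i> h + U (- \<i>) h = sc 2 (h * h)"
    using sc_add_left[of 1 1 "h * h"] by (simp add: U_def sc_minus_left sc_one)
  then have "2 * p (h * h) \<le> 2 * p h"
    using p_add[OF U_closed[OF C(1), of \<i>] U_closed[OF C(1), of "- \<i>"]] U_isom[OF C(1)]
      p_sc[OF mult_closed[OF C(1) C(1)], of 2] by simp
  then have "p h * p h \<le> 1 * p h"
    using p_cstar[OF C(1)] sa(1) by (simp add: power2_eq_square)
  then show ?thesis
    using p_nonneg[OF C(1)] mult_right_le_imp_le[of "p h" "p h" 1] by fastforce
qed

section \<open>Convergence of the square root iteration\<close>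

context
  fixes r \<beta> :: real
  assumes r: "0 \<le> r" "r < 1" and \<beta>_def: "\<beta> = 1 - sqrt (1 - r)"
begin

text \<open>\<open>\<beta>\<close> is the smaller fixed point of t -> (r + t^2)/2, the iteration on
  real numbers. So the ball of radius \<open>\<beta>\<close> is invariant, and
  \<open>\<beta> < 1\<close> serves as rate of contraction.\<close>

lemma sqrt_iter_bound_aux: "0 \<le> \<beta>" "\<beta> < 1" "r + \<beta> * \<beta> = 2 * \<beta>"
proof -
  have "sqrt (1 - r) * sqrt (1 - r) = 1 - r" using r by simp
  then show "r + \<beta> * \<beta> = 2 * \<beta>" unfolding \<beta>_def by (simp add: algebra_simps)
  show "0 \<le> \<beta>" "\<beta> < 1" unfolding \<beta>_def using r by auto
qed

lemma p_sqrt_iter_le: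
  assumes a: "a \<in> C" "p a \<le> r"
  shows "p (sqrt_iter k a) \<le> \<beta>"
proof (induction k)
  case 0
  show ?case using sqrt_iter_bound_aux by (simp add: p_zero)
next
  case (Suc k)
  let ?x = "sqrt_iter k a"
  have x: "?x \<in> C" using a sqrt_iter_closed by blast
  have "p (a + ?x * ?x) \<le> p a + p ?x * p ?x"
    using p_add[OF a(1) mult_closed[OF x x]] p_mult[OF x x] by simp
  also have "\<dots> \<le> r + \<beta> * \<beta>"
    using a Suc p_nonneg[OF x] by (intro add_mono mult_mono) auto
  finally show ?case
    using sqrt_iter_bound_aux p_sc[of "a + ?x * ?x" "1/2"] add_closed mult_closed x a by simp
qed

text \<open>Splitting x^2 - y^2 as x(x - y) + (x - y)y needs no commutativity. The factor 2 cancels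
  against the 1/2 in \<open>sqrt_iter\<close>, which leaves the rate \<open>\<beta>\<close>.\<close>

lemma p_square_diff_le:
  assumes x: "x \<in> C" "p x \<le> \<beta>" and y: "y \<in> C" "p y \<le> \<beta>"
  shows "p (x * x - y * y) \<le> 2 * \<beta> * p (x - y)"
proof -
  have d: "x - y \<in> C" using x y diff_closed by blast
  have "x * x - y * y = x * (x - y) + (x - y) * y" by (simp add: algebra_simps)
  then have "p (x * x - y * y) \<le> p x * p (x - y) + p (x - y) * p y"
    using p_add[OF mult_closed[OF x(1) d] mult_closed[OF d y(1)]] p_mult[OF x(1) d]
      p_mult[OF d y(1)] by simp
  also have "\<dots> \<le> \<beta> * p (x - y) + p (x - y) * \<beta>"
    using x y p_nonneg[OF d] by (intro add_mono mult_left_mono mult_right_mono) auto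
  finally show ?thesis by simp
qed

lemma p_sqrt_iter_step:
  assumes a: "a \<in> C" "p a \<le> r"
  shows "p (sqrt_iter (Suc k) a - sqrt_iter k a) \<le> \<beta> ^ k"
proof (induction k)
  case 0
  \<comment> \<open>The first increment is \<open>a\<close>/2, and r/2 is below
    \<open>\<beta> ^ 0\<close> = 1.\<close>
  show ?case using p_sc[OF a(1), of "1/2"] a r by simp
next
  case (Suc k)
  let ?x = "sqrt_iter (Suc k) a" and ?y = "sqrt_iter k a"
  have C: "?x \<in> C" "?y \<in> C" using a sqrt_iter_closed by blast+
  have "sqrt_iter (Suc (Suc k)) a - ?x = sc (1/2) (?x * ?x - ?y * ?y)"
    by (simp only: sqrt_iter.simps(2)[of "Suc k"] sqrt_iter.simps(2)[of k "a"]
        sc_diff_right[symmetric]) (simp add: sc_diff_right sc_add_right)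
  then have "p (sqrt_iter (Suc (Suc k)) a - ?x) = p (?x * ?x - ?y * ?y) / 2"
    using p_sc[of "?x * ?x - ?y * ?y" "1/2"] C by (simp add: diff_closed mult_closed)
  also have "\<dots> \<le> \<beta> * p (?x - ?y)"
    using p_square_diff_le[OF C(1) _ C(2)] p_sqrt_iter_le[OF a] by fastforce
  also have "\<dots> \<le> \<beta> * \<beta> ^ k"
    using Suc sqrt_iter_bound_aux by (intro mult_left_mono) auto
  finally show ?case by simp
qed

lemma p_sqrt_iter_diff_index:
  assumes a: "a \<in> C" "p a \<le> r" and "n \<le> m"
  shows "p (sqrt_iter m a - sqrt_iter n a) \<le> \<beta> ^ n / (1 - \<beta>)"
proof -
  \<comment> \<open>The right-hand side is the geometric sum from \<open>\<beta> ^ n\<close> to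
    \<open>\<beta> ^ (m - 1)\<close>; the induction needs this exact form, and
    \<open>\<beta> ^ m\<close> is dropped afterwards.\<close>
  have "p (sqrt_iter m a - sqrt_iter n a) \<le> (\<beta> ^ n - \<beta> ^ m) / (1 - \<beta>)"
    using \<open>n \<le> m\<close>
  proof (induction m rule: dec_induct)
    case base
    show ?case by (simp add: p_zero)
  next
    case (step m)
    have "p (sqrt_iter (Suc m) a - sqrt_iter n a) \<le> \<beta> ^ m + (\<beta> ^ n - \<beta> ^ m) / (1 - \<beta>)"
      using step.IH p_sqrt_iter_step[OF a, of m]
        p_diff_triangle[of "sqrt_iter (Suc m) a" "sqrt_iter m a" "sqrt_iter n a"]
        sqrt_iter_closed[OF a(1)] by (smt (verit, ccfv_threshold))
    also have "\<dots> = (\<beta> ^ n - \<beta> ^ Suc m) / (1 - \<beta>)"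
      using sqrt_iter_bound_aux by (simp add: field_simps)
    finally show ?case .
  qed
  also have "\<dots> \<le> \<beta> ^ n / (1 - \<beta>)"
    using sqrt_iter_bound_aux by (intro divide_right_mono) auto
  finally show ?thesis .
qed

text \<open>With d = p(a - a'), the errors satisfy d_(k+1) <= d/2 + \<beta> d_k, a recursion that
  preserves the bound d/(1 - \<beta>). Uniformity in k matters because on the diagonal the index and
  the argument change together.\<close>

lemma p_sqrt_iter_diff_arg:
  assumes a: "a \<in> C" "p a \<le> r" and a': "a' \<in> C" "p a' \<le> r"
  shows "p (sqrt_iter k a - sqrt_iter k a') \<le> p (a - a') / (1 - \<beta>)"
proof (induction k)
  case 0
  show ?case using sqrt_iter_bound_aux p_nonneg[OF diff_closed[OF a(1) a'(1)]] by (simp add: p_zero)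
next
  case (Suc k)
  let ?x = "sqrt_iter k a" and ?y = "sqrt_iter k a'"
  let ?d = "p (a - a')"
  have C: "?x \<in> C" "?y \<in> C" using a a' sqrt_iter_closed by blast+
  have d: "0 \<le> ?d" using p_nonneg[OF diff_closed[OF a(1) a'(1)]] .
  have eq: "sqrt_iter (Suc k) a - sqrt_iter (Suc k) a'
      = sc (1/2) ((a - a') + (?x * ?x - ?y * ?y))"
    by (simp add: sc_diff_right sc_add_right)
  have "p (sqrt_iter (Suc k) a - sqrt_iter (Suc k) a')
      = p ((a - a') + (?x * ?x - ?y * ?y)) / 2"
    unfolding eq using C a a'
    by (subst p_sc) (auto intro!: add_closed diff_closed mult_closed)
  also have "\<dots> \<le> (?d + 2 * \<beta> * p (?x - ?y)) / 2"
    using p_square_diff_le[OF C(1) p_sqrt_iter_le[OF a] C(2) p_sqrt_iter_le[OF a']]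
      p_add[OF diff_closed[OF a(1) a'(1)] diff_closed[OF mult_closed mult_closed], OF C(1,1,2,2)]
    by simp
  also have "\<dots> \<le> (?d + 2 * \<beta> * (?d / (1 - \<beta>))) / 2"
    using Suc sqrt_iter_bound_aux by (intro divide_right_mono add_left_mono mult_left_mono) auto
  also have "\<dots> = (?d / 2 + \<beta> / 2 * ?d) / (1 - \<beta>)"
    using sqrt_iter_bound_aux by (simp add: field_simps)
  also have "\<dots> \<le> ?d / (1 - \<beta>)"
  proof (rule divide_right_mono)
    have "\<beta> * ?d \<le> 1 * ?d" using d sqrt_iter_bound_aux by (intro mult_right_mono) auto
    then show "?d / 2 + \<beta> / 2 * ?d \<le> ?d" by simp
  qed (use sqrt_iter_bound_aux in simp)
  finally show ?case .
qed

end

end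

section \<open>Cauchy sequences and contractivity\<close>

context cstar_seminormed_algebra
begin

definition cauchy_seqs :: "(nat \<Rightarrow> 'a) set" where
  "cauchy_seqs = {x. range x \<subseteq> C \<and> (\<forall>\<epsilon>>0. \<exists>N. \<forall>m\<ge>N. \<forall>n\<ge>N. p (x m - x n) < \<epsilon>)}"

lemma cauchy_seqs_closed: "x \<in> cauchy_seqs \<Longrightarrow> x n \<in> C"
  by (auto simp: cauchy_seqs_def)

lemma cauchy_seqsD:
  "x \<in> cauchy_seqs \<Longrightarrow> 0 < \<epsilon> \<Longrightarrow> \<exists>N. \<forall>m\<ge>N. \<forall>n\<ge>N. p (x m - x n) < \<epsilon>"
  by (auto simp: cauchy_seqs_def)

lemma cauchy_seqsI:
  assumes C: "\<And>n. x n \<in> C"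
    and "\<And>\<epsilon>. 0 < \<epsilon> \<Longrightarrow> \<exists>N. \<forall>n\<ge>N. \<forall>m\<ge>n. p (x m - x n) < \<epsilon>"
  shows "x \<in> cauchy_seqs"
  unfolding cauchy_seqs_def
proof (intro CollectI conjI allI impI)
  show "range x \<subseteq> C" using C by auto
  fix \<epsilon> :: real assume "0 < \<epsilon>"
  then obtain N where N: "p (x m - x n) < \<epsilon>" if "N \<le> n" "n \<le> m" for m n
    using assms(2) by metis
  have "p (x m - x n) < \<epsilon>" if "N \<le> m" "N \<le> n" for m n
    using N[of n m] N[of m n] that p_diff_commute[OF C C, of m n] by (cases m n rule: le_cases) auto
  then show "\<exists>N. \<forall>m\<ge>N. \<forall>n\<ge>N. p (x m - x n) < \<epsilon>" by blast
qed

lemma cauchy_seqs_dominated: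
  assumes C: "\<And>n. x n \<in> C" and y: "y \<in> cauchy_seqs"
    and le: "\<And>m n. p (x m - x n) \<le> M * p (y m - y n)"
  shows "x \<in> cauchy_seqs"
proof (rule cauchy_seqsI[OF C])
  fix \<epsilon> :: real assume \<epsilon>: "0 < \<epsilon>"
  \<comment> \<open>\<open>M\<close> may be 0 or negative, so |M| + 1 takes its place as a
    divisor.\<close>
  then have "0 < \<epsilon> / (\<bar>M\<bar> + 1)" by simp
  then obtain N where N: "p (y m - y n) < \<epsilon> / (\<bar>M\<bar> + 1)" if "m \<ge> N" "n \<ge> N" for m n
    using cauchy_seqsD[OF y] by metis
  have "p (x m - x n) < \<epsilon>" if "m \<ge> N" "n \<ge> N" for m n
  proof -
    have nn: "0 \<le> p (y m - y n)" using y cauchy_seqs_closed diff_closed p_nonneg by blast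
    have "p (x m - x n) \<le> (\<bar>M\<bar> + 1) * p (y m - y n)"
    proof (rule order_trans[OF le])
      show "M * p (y m - y n) \<le> (\<bar>M\<bar> + 1) * p (y m - y n)"
        by (rule mult_right_mono[OF _ nn]) linarith
    qed
    also have "\<dots> < \<epsilon>"
      using N[OF that] by (simp add: pos_less_divide_eq mult.commute)
    finally show ?thesis .
  qed
  then show "\<exists>N. \<forall>n\<ge>N. \<forall>m\<ge>n. p (x m - x n) < \<epsilon>" by (meson order_trans)
qed

lemma cauchy_seqs_add:
  assumes x: "x \<in> cauchy_seqs" and y: "y \<in> cauchy_seqs"
  shows "x + y \<in> cauchy_seqs"
proof (rule cauchy_seqsI)
  show "(x + y) n \<in> C" for n
    using x y by (simp add: cauchy_seqs_closed add_closed)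
  fix \<epsilon> :: real assume "0 < \<epsilon>"
  then have "0 < \<epsilon> / 2" by simp
  then obtain N1 N2 where N: "\<And>m n. m \<ge> N1 \<Longrightarrow> n \<ge> N1 \<Longrightarrow> p (x m - x n) < \<epsilon> / 2"
    "\<And>m n. m \<ge> N2 \<Longrightarrow> n \<ge> N2 \<Longrightarrow> p (y m - y n) < \<epsilon> / 2"
    using cauchy_seqsD[OF x] cauchy_seqsD[OF y] by metis
  have "p ((x + y) m - (x + y) n) < \<epsilon>" if "n \<ge> max N1 N2" "m \<ge> n" for m n
  proof -
    have "(x + y) m - (x + y) n = (x m - x n) + (y m - y n)" by simp
    then have "p ((x + y) m - (x + y) n) \<le> p (x m - x n) + p (y m - y n)"
      using p_add x y by (metis cauchy_seqs_closed diff_closed)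
    with N(1)[of m n] N(2)[of m n] that show ?thesis by simp
  qed
  then show "\<exists>N. \<forall>n\<ge>N. \<forall>m\<ge>n. p ((x + y) m - (x + y) n) < \<epsilon>" by blast
qed

lemma cauchy_seqs_convergent:
  assumes x: "x \<in> cauchy_seqs"
  shows "convergent (\<lambda>n. p (x n))"
proof -
  have "Cauchy (\<lambda>n. p (x n))"
  proof (rule metric_CauchyI)
    fix \<epsilon> :: real assume "0 < \<epsilon>"
    then obtain N where "\<forall>m\<ge>N. \<forall>n\<ge>N. p (x m - x n) < \<epsilon>"
      using cauchy_seqsD[OF x] by blast
    then show "\<exists>N. \<forall>m\<ge>N. \<forall>n\<ge>N. dist (p (x m)) (p (x n)) < \<epsilon>"
      using abs_p_diff x cauchy_seqs_closed unfolding dist_real_def by (meson order_le_less_trans)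
  qed
  then show ?thesis by (simp add: Cauchy_convergent_iff)
qed

lemma cauchy_seqs_bounded:
  assumes "x \<in> cauchy_seqs"
  obtains M where "0 \<le> M" "\<And>n. p (x n) \<le> M"
proof -
  obtain M where "M > 0" "\<And>n. norm (p (x n)) \<le> M"
    using cauchy_seqs_convergent[OF assms] convergent_imp_Bseq by (metis BseqE)
  with that show ?thesis by (metis abs_ge_self less_imp_le order_trans real_norm_def)
qed

lemma cauchy_seqs_mult:
  assumes x: "x \<in> cauchy_seqs" and y: "y \<in> cauchy_seqs"
  shows "x * y \<in> cauchy_seqs"
proof (rule cauchy_seqsI)
  note C = cauchy_seqs_closed[OF x] cauchy_seqs_closed[OF y]
  show "(x * y) n \<in> C" for n
    using C by (simp add: mult_closed)
  obtain A where A: "0 \<le> A" "\<And>n. p (x n) \<le> A" using cauchy_seqs_bounded[OF x] by blast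
  obtain B where B: "0 \<le> B" "\<And>n. p (y n) \<le> B" using cauchy_seqs_bounded[OF y] by blast
  fix \<epsilon> :: real assume \<epsilon>: "0 < \<epsilon>"
  define \<delta> where "\<delta> = \<epsilon> / (A + B + 1)"
  have \<delta>: "0 < \<delta>" "(A + B) * \<delta> < \<epsilon>"
    using A(1) B(1) \<epsilon> by (auto simp: \<delta>_def field_simps)
  from \<delta> obtain N1 N2 where N: "\<And>m n. m \<ge> N1 \<Longrightarrow> n \<ge> N1 \<Longrightarrow> p (x m - x n) < \<delta>"
    "\<And>m n. m \<ge> N2 \<Longrightarrow> n \<ge> N2 \<Longrightarrow> p (y m - y n) < \<delta>"
    using cauchy_seqsD[OF x] cauchy_seqsD[OF y] by metis
  have "p ((x * y) m - (x * y) n) < \<epsilon>" if "n \<ge> max N1 N2" "m \<ge> n" for m n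
  proof -
    have "(x * y) m - (x * y) n = x m * (y m - y n) + (x m - x n) * y n"
      by (simp add: algebra_simps)
    then have "p ((x * y) m - (x * y) n) \<le> p (x m * (y m - y n)) + p ((x m - x n) * y n)"
      using p_add[of "x m * (y m - y n)" "(x m - x n) * y n"] C
      by (simp add: diff_closed mult_closed)
    also have "\<dots> \<le> p (x m) * p (y m - y n) + p (x m - x n) * p (y n)"
      using C by (intro add_mono p_mult diff_closed) auto
    also have "\<dots> \<le> A * \<delta> + \<delta> * B"
      using A B N(1)[of m n] N(2)[of m n] that C p_nonneg diff_closed \<delta>
      by (intro add_mono mult_mono) auto
    also have "\<dots> < \<epsilon>" using \<delta> by (simp add: algebra_simps)
    finally show ?thesis .
  qed
  then show "\<exists>N. \<forall>n\<ge>N. \<forall>m\<ge>n. p ((x * y) m - (x * y) n) < \<epsilon>" by blast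
qed

lemma cauchy_seqs_sc: "x \<in> cauchy_seqs \<Longrightarrow> (\<lambda>n. sc c (x n)) \<in> cauchy_seqs"
  by (rule cauchy_seqs_dominated[of _ x "cmod c"])
    (auto simp: cauchy_seqs_closed sc_closed sc_diff_right[symmetric] p_sc diff_closed)

lemma cauchy_seqs_st: "x \<in> cauchy_seqs \<Longrightarrow> (\<lambda>n. st (x n)) \<in> cauchy_seqs"
  by (rule cauchy_seqs_dominated[of _ x 1])
    (auto simp: cauchy_seqs_closed st_closed st_diff[symmetric] p_st diff_closed)

lemma cauchy_seqs_const: "a \<in> C \<Longrightarrow> (\<lambda>_. a) \<in> cauchy_seqs"
  by (auto simp: cauchy_seqs_def p_zero)

lemma star_algebra_cauchy_seqs:
  "star_algebra cauchy_seqs (\<lambda>c x n. sc c (x n)) (\<lambda>x n. st (x n))"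
proof
  show "0 \<in> cauchy_seqs" using cauchy_seqs_const[OF zero_closed] by (simp add: zero_fun_def)
qed (auto intro: cauchy_seqs_add cauchy_seqs_mult cauchy_seqs_sc cauchy_seqs_st
    simp: sc_add_right sc_add_left sc_sc sc_one sc_mult_left sc_mult_right st_add st_sc st_mult st_st)

text \<open>Taking the n-th iterate at the n-th term yields a root inside the sequence algebra,
  without completeness of \<open>C\<close>. Before \<open>N\<close>, where no bound on
  \<open>a\<close> is available, 0 is the default.\<close>

lemma cauchy_seqs_sqrt_iter:
  assumes a: "a \<in> cauchy_seqs" and le: "\<And>n. N \<le> n \<Longrightarrow> p (a n) \<le> r" and r: "0 \<le> r" "r < 1"
  shows "(\<lambda>n. if N \<le> n then sqrt_iter n (a n) else 0) \<in> cauchy_seqs" (is "?b \<in> _")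
proof (rule cauchy_seqsI)
  define \<beta> where "\<beta> = 1 - sqrt (1 - r)"
  note \<beta> = sqrt_iter_bound_aux[OF r \<beta>_def]
  note C = cauchy_seqs_closed[OF a]
  show "?b n \<in> C" for n using C by (simp add: sqrt_iter_closed zero_closed)
  fix \<epsilon> :: real assume \<epsilon>: "0 < \<epsilon>"
  \<comment> \<open>Two errors occur, one from changing the argument at index m and one from
    changing the index; each stays below \<delta>/(1 - \<beta>) = \<epsilon>/2.\<close>
  define \<delta> where "\<delta> = \<epsilon> / 2 * (1 - \<beta>)"
  have \<delta>: "0 < \<delta>" using \<epsilon> \<beta> by (simp add: \<delta>_def)
  obtain N1 where N1: "\<And>m n. m \<ge> N1 \<Longrightarrow> n \<ge> N1 \<Longrightarrow> p (a m - a n) < \<delta>"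
    using cauchy_seqsD[OF a \<delta>] by metis
  have "(\<lambda>n. \<beta> ^ n) \<longlonglongrightarrow> 0" using \<beta> by (intro LIMSEQ_realpow_zero)
  then obtain N2 where N2: "\<And>n. n \<ge> N2 \<Longrightarrow> \<beta> ^ n < \<delta>"
    using \<delta> \<beta> unfolding LIMSEQ_iff by (metis diff_zero abs_of_nonneg real_norm_def zero_le_power)
  have "p (?b m - ?b n) < \<epsilon>" if "n \<ge> max N (max N1 N2)" "m \<ge> n" for m n
  proof -
    have "p (?b m - ?b n) \<le> p (sqrt_iter m (a m) - sqrt_iter m (a n))
        + p (sqrt_iter m (a n) - sqrt_iter n (a n))"
      using that C by (auto intro!: p_diff_triangle sqrt_iter_closed)
    also have "\<dots> \<le> p (a m - a n) / (1 - \<beta>) + \<beta> ^ n / (1 - \<beta>)"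
      using that C le
      by (intro add_mono p_sqrt_iter_diff_arg[OF r \<beta>_def] p_sqrt_iter_diff_index[OF r \<beta>_def]) auto
    also have "\<dots> < \<delta> / (1 - \<beta>) + \<delta> / (1 - \<beta>)"
      using that \<beta> by (intro add_strict_mono divide_strict_right_mono N1 N2) auto
    also have "\<delta> / (1 - \<beta>) = \<epsilon> / 2"
      unfolding \<delta>_def using \<beta> by (intro nonzero_mult_div_cancel_right) simp
    finally show ?thesis by simp
  qed
  then show "\<exists>N. \<forall>n\<ge>N. \<forall>m\<ge>n. p (?b m - ?b n) < \<epsilon>" by blast
qed

text \<open>If p(x n) is eventually at most some number below 1, then for h = x^* x the equation 2b
  - b^2 = h^2 has a diagonal approximate solution. Its defect is null for p, hence exactly 0 for q,
  and \<open>p_le_one_if_sqrt_complement\<close> applies to q. The gap between \<open>\<rho>\<close>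
  and \<open>\<delta>\<close> leaves a strict inequality after rescaling.\<close>

lemma cstar_seminorm_on_cauchy_seqs_contractive:
  assumes q: "cstar_seminormed_algebra cauchy_seqs (\<lambda>c x n. sc c (x n)) (\<lambda>x n. st (x n)) q"
    and q_null: "\<And>x. x \<in> cauchy_seqs \<Longrightarrow> (\<lambda>n. p (x n)) \<longlonglongrightarrow> 0 \<Longrightarrow> q x = 0"
    and x: "x \<in> cauchy_seqs" and le: "\<And>n. N \<le> n \<Longrightarrow> p (x n) \<le> \<rho>" and "\<rho> < \<delta>"
  shows "q x \<le> \<delta>"
proof -
  interpret Q: cstar_seminormed_algebra cauchy_seqs "\<lambda>c x n. sc c (x n)" "\<lambda>x n. st (x n)" q
    by fact
  have unit: "q x \<le> 1"
    if x: "x \<in> cauchy_seqs" and le: "\<And>n. N \<le> n \<Longrightarrow> p (x n) \<le> \<rho>" and "\<rho> < 1" for x \<rho>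
  proof -
    have \<rho>: "0 \<le> \<rho>"
      using le[of N] p_nonneg[OF cauchy_seqs_closed[OF x]] order_trans by blast
    \<comment> \<open>x^* x is self-adjoint, and q takes the value (q x)^2 on it, so a bound for
      self-adjoint elements suffices.\<close>
    define h where "h = (\<lambda>n. st (x n)) * x"
    \<comment> \<open>By the C*-identity, used twice, p(h^2) = p(x)^4.\<close>
    define r where "r = (\<rho>\<^sup>2)\<^sup>2"
    define b where "b = (\<lambda>n. if N \<le> n then sqrt_iter n ((h * h) n) else 0)"
    define \<beta> where "\<beta> = 1 - sqrt (1 - r)"
    have r: "0 \<le> r" "r < 1"
      using \<rho> \<open>\<rho> < 1\<close> by (auto simp: r_def power_less_one_iff)
    note \<beta> = sqrt_iter_bound_aux[OF r \<beta>_def]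
    have h: "h \<in> cauchy_seqs" unfolding h_def using x Q.mult_closed Q.st_closed by blast
    have hC: "h n \<in> C" for n using h cauchy_seqs_closed by blast
    have st_h: "st (h n) = h n" for n by (simp add: h_def st_mult st_st)
    have hh_le: "p ((h * h) n) \<le> r" if "N \<le> n" for n
    proof -
      have "p (h n) = (p (x n))\<^sup>2" using x by (simp add: h_def p_cstar cauchy_seqs_closed)
      moreover have "p (h n * h n) = (p (h n))\<^sup>2" using p_cstar[OF hC[of n]] st_h by simp
      ultimately show ?thesis
        using le[OF that] p_nonneg[OF cauchy_seqs_closed[OF x]] unfolding r_def
        by (auto intro!: power_mono)
    qed
    have hh: "h * h \<in> cauchy_seqs" using h Q.mult_closed by blast
    have b: "b \<in> cauchy_seqs"
      unfolding b_def using hh hh_le r by (rule cauchy_seqs_sqrt_iter)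
    have "(\<lambda>n. p ((b + b - b * b - h * h) n)) \<longlonglongrightarrow> 0"
    proof (rule tendsto_0_le[where K = 1])
      show "(\<lambda>n. 2 * \<beta> ^ n) \<longlonglongrightarrow> 0"
        using \<beta> by (intro tendsto_mult_right_zero LIMSEQ_realpow_zero)
      have "norm (p ((b + b - b * b - h * h) n)) \<le> norm (2 * \<beta> ^ n) * 1" if "N \<le> n" for n
      proof -
        let ?y = "sqrt_iter n ((h * h) n)" and ?z = "sqrt_iter (Suc n) ((h * h) n)"
        have C: "?y \<in> C" "?z \<in> C"
          using cauchy_seqs_closed[OF hh] sqrt_iter_closed by blast+
        \<comment> \<open>With z the iterate following y, the defect 2y - y^2 - h^2 is 2(y - z), a
          single step of the iteration, which decays geometrically.\<close>
        have "sc 2 ?z = (h * h) n + ?y * ?y" by (simp add: sc_sc sc_one)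
        moreover have "sc 2 ?y = ?y + ?y" using sc_add_left[of 1 1 ?y] by (simp add: sc_one)
        ultimately have "(b + b - b * b - h * h) n = sc 2 (?y - ?z)"
          using that by (simp add: b_def sc_diff_right del: sqrt_iter.simps)
        then have "p ((b + b - b * b - h * h) n) = 2 * p (?z - ?y)"
          using C by (simp add: p_sc diff_closed p_diff_commute del: sqrt_iter.simps)
        also have "\<dots> \<le> 2 * \<beta> ^ n"
          using p_sqrt_iter_step[OF r \<beta>_def _ hh_le[OF that], of n] cauchy_seqs_closed[OF hh] by simp
        finally show ?thesis
          using p_nonneg[OF diff_closed[OF C(2,1)]] \<open>p _ = 2 * p (?z - ?y)\<close> \<beta> by simp
      qed
      then show "\<forall>\<^sub>F n in sequentially. norm (p ((b + b - b * b - h * h) n)) \<le> norm (2 * \<beta> ^ n) * 1"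
        by (auto simp: eventually_sequentially)
    qed
    then have "q (b + b - b * b - h * h) = 0"
      using b h by (intro q_null) (auto intro!: Q.diff_closed Q.add_closed Q.mult_closed)
    moreover have "(\<lambda>n. st (h n)) = h" using st_h by auto
    moreover have "(\<lambda>n. st (b n)) = b"
      by (rule ext) (auto simp: b_def st_zero st_mult st_h intro!: st_sqrt_iter)
    moreover have "h * b = b * h"
      by (rule ext) (auto simp: b_def mult.assoc intro!: sqrt_iter_commute)
    ultimately have "q h \<le> 1"
      using Q.p_le_one_if_sqrt_complement[OF h b] by blast
    then have "(q x)\<^sup>2 \<le> 1" using Q.p_cstar[OF x] by (simp add: h_def)
    then show "q x \<le> 1" using power2_le_imp_le[of "q x" 1] by simp
  qed
  have \<delta>: "0 < \<delta>"
    using le[of N] p_nonneg[OF cauchy_seqs_closed[OF x], of N] \<open>\<rho> < \<delta>\<close> by simp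
  let ?y = "\<lambda>n. sc (1 / \<delta>) (x n)"
  have "q ?y \<le> 1"
  proof (rule unit)
    show "?y \<in> cauchy_seqs" using x by (rule cauchy_seqs_sc)
    show "p (?y n) \<le> \<rho> / \<delta>" if "N \<le> n" for n
      using le[OF that] \<delta> p_sc[OF cauchy_seqs_closed[OF x]]
      by (simp add: norm_divide divide_right_mono)
    show "\<rho> / \<delta> < 1" using \<delta> \<open>\<rho> < \<delta>\<close> by simp
  qed
  then show ?thesis using Q.p_sc[OF x, of "1 / \<delta>"] \<delta> by (simp add: norm_divide)
qed

end

section \<open>Universal C*-algebras\<close>

lemma star_algebra_free: "star_algebra (free_star_alg G) fscale fstar"
  by standard
    (auto intro: free_star_alg_zero free_star_alg_add free_star_alg_mult free_star_alg_fscale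
      free_star_alg_fstar
      simp: fscale_add_right fscale_add_left fscale_fscale fscale_one fscale_mult_left
      fscale_mult_right fstar_add fstar_fscale fstar_mult fstar_fstar)

lemma cstar_seminorm_iff:
  "cstar_seminorm G R p \<longleftrightarrow>
    cstar_seminormed_algebra (free_star_alg G) fscale fstar p \<and> (\<forall>r\<in>R. p r = 0)"
  unfolding cstar_seminorm_def cstar_seminormed_algebra_def cstar_seminormed_algebra_axioms_def
  using star_algebra_free by blast

lemma cstar_seminormed_algebraI:
  "cstar_seminorm G R p \<Longrightarrow> cstar_seminormed_algebra (free_star_alg G) fscale fstar p"
  by (simp add: cstar_seminorm_iff)

text \<open>\<open>univ_seminorm\<close> is a supremum of reals and needs sets bounded above. A
  bound at each generator suffices, since bounds pass through sums, products, multiples and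
  stars.\<close>

locale bounded_relations =
  fixes G :: "'g set" and R :: "'g free_alg set"
  assumes gen_bounded: "g \<in> G \<Longrightarrow> \<exists>M. \<forall>p. cstar_seminorm G R p \<longrightarrow> p (gen g) \<le> M"
begin

abbreviation "F \<equiv> free_star_alg G"
abbreviation "s \<equiv> univ_seminorm G R"

section \<open>The supremum of the C*-seminorms\<close>

lemma seminorm_bounded: "x \<in> F \<Longrightarrow> \<exists>M. \<forall>p. cstar_seminorm G R p \<longrightarrow> p x \<le> M"
proof (induction x rule: free_star_alg_induct)
  case zero
  have "p 0 \<le> 0" if "cstar_seminorm G R p" for p
    using cstar_seminormed_algebra.p_zero[OF cstar_seminormed_algebraI[OF that]] by simp
  then show ?case by blast
next
  case (gen g)
  then show ?case by (rule gen_bounded)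
next
  case (add x y)
  then obtain A B where AB: "\<And>p. cstar_seminorm G R p \<Longrightarrow> p x \<le> A"
    "\<And>p. cstar_seminorm G R p \<Longrightarrow> p y \<le> B" by blast
  have "p (x + y) \<le> A + B" if p: "cstar_seminorm G R p" for p
    using cstar_seminormed_algebra.p_add[OF cstar_seminormed_algebraI[OF p] add.hyps] AB[OF p] by simp
  then show ?case by blast
next
  case (mult x y)
  then obtain A B where AB: "\<And>p. cstar_seminorm G R p \<Longrightarrow> p x \<le> A"
    "\<And>p. cstar_seminorm G R p \<Longrightarrow> p y \<le> B" by blast
  have "p (x * y) \<le> A * B" if p: "cstar_seminorm G R p" for p
  proof -
    interpret P: cstar_seminormed_algebra F fscale fstar p
      using p by (rule cstar_seminormed_algebraI)
    have "p x * p y \<le> A * B"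
      using AB[OF p] P.p_nonneg[OF mult.hyps(1)] P.p_nonneg[OF mult.hyps(2)]
      by (intro mult_mono) auto
    then show ?thesis using P.p_mult[OF mult.hyps] by simp
  qed
  then show ?case by blast
next
  case (scale x c)
  then obtain A where A: "\<And>p. cstar_seminorm G R p \<Longrightarrow> p x \<le> A" by blast
  have "p (fscale c x) \<le> cmod c * A" if p: "cstar_seminorm G R p" for p
    using cstar_seminormed_algebra.p_sc[OF cstar_seminormed_algebraI[OF p] scale.hyps] A[OF p]
    by (simp add: mult_left_mono)
  then show ?case by blast
next
  case (star x)
  then show ?case
    using cstar_seminormed_algebra.p_st[OF cstar_seminormed_algebraI] by metis
qed

lemma bdd_above_seminorms: "x \<in> F \<Longrightarrow> bdd_above {p x | p. cstar_seminorm G R p}"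
  using seminorm_bounded[of x] unfolding bdd_above_def by blast

text \<open>Makes the set under \<open>Sup\<close> nonempty.\<close>

lemma cstar_seminorm_zero: "cstar_seminorm G R (\<lambda>_. 0)"
  by (simp add: cstar_seminorm_def)

lemma seminorm_le_univ: "x \<in> F \<Longrightarrow> cstar_seminorm G R p \<Longrightarrow> p x \<le> s x"
  unfolding univ_seminorm_def using bdd_above_seminorms by (intro cSup_upper) auto

lemma univ_seminorm_le: "(\<And>p. cstar_seminorm G R p \<Longrightarrow> p x \<le> M) \<Longrightarrow> s x \<le> M"
  unfolding univ_seminorm_def using cstar_seminorm_zero by (intro cSup_least) auto

lemma univ_seminorm_nonneg: "x \<in> F \<Longrightarrow> 0 \<le> s x"
  using seminorm_le_univ[OF _ cstar_seminorm_zero] .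

lemma univ_seminorm_rel: "r \<in> R \<Longrightarrow> s r = 0"
  unfolding univ_seminorm_def
  using cstar_seminorm_zero by (auto simp: cstar_seminorm_def intro!: cSup_eq_maximum)

text \<open>C*-seminorms are stable under pointwise suprema. The rewrite identifies the Cauchy
  sequences of the locale with \<open>univ_cauchy\<close>, from which the quotient is
  formed.\<close>

sublocale cstar_seminormed_algebra F fscale fstar s
  rewrites "cstar_seminormed_algebra.cauchy_seqs F s = univ_cauchy G R"
proof -
  interpret star_algebra F fscale fstar by (rule star_algebra_free)
  have scale_le: "s (fscale c x) \<le> cmod c * s x" if x: "x \<in> F" for c x
  proof (rule univ_seminorm_le)
    fix p assume p: "cstar_seminorm G R p"
    show "p (fscale c x) \<le> cmod c * s x"
      using cstar_seminormed_algebra.p_sc[OF cstar_seminormed_algebraI[OF p] x]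
        seminorm_le_univ[OF x p] by (simp add: mult_left_mono)
  qed
  show *: "cstar_seminormed_algebra F fscale fstar s"
  proof
    fix x y assume x: "x \<in> F" and y: "y \<in> F"
    show "s (x + y) \<le> s x + s y"
    proof (rule univ_seminorm_le)
      fix p assume p: "cstar_seminorm G R p"
      show "p (x + y) \<le> s x + s y"
        using cstar_seminormed_algebra.p_add[OF cstar_seminormed_algebraI[OF p] x y]
          seminorm_le_univ[OF x p] seminorm_le_univ[OF y p] by simp
    qed
    show "s (x * y) \<le> s x * s y"
    proof (rule univ_seminorm_le)
      fix p assume p: "cstar_seminorm G R p"
      interpret P: cstar_seminormed_algebra F fscale fstar p
        using p by (rule cstar_seminormed_algebraI)
      have "p x * p y \<le> s x * s y"
        using seminorm_le_univ[OF x p] seminorm_le_univ[OF y p] P.p_nonneg x y univ_seminorm_nonneg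
        by (intro mult_mono) auto
      then show "p (x * y) \<le> s x * s y" using P.p_mult[OF x y] by simp
    qed
  next
    fix x assume x: "x \<in> F"
    show "0 \<le> s x" using x by (rule univ_seminorm_nonneg)
    show "s (fscale c x) = cmod c * s x" for c
    proof (cases "c = 0")
      case True
      then show ?thesis
        using scale_le[OF x, of c] univ_seminorm_nonneg[OF sc_closed[OF x], of c] by simp
    next
      case False
      \<comment> \<open>The upper estimate, applied to the inverse scalar, yields the lower
        one.\<close>
      have "s x = s (fscale (inverse c) (fscale c x))" using False by (simp add: sc_sc sc_one)
      also have "\<dots> \<le> s (fscale c x) / cmod c"
        using scale_le[OF sc_closed[OF x], of "inverse c" c]
        by (simp add: norm_inverse divide_inverse mult.commute)
      finally have "cmod c * s x \<le> s (fscale c x)" using False by (simp add: field_simps)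
      with scale_le[OF x, of c] show ?thesis by simp
    qed
    have xx: "fstar x * x \<in> F" using x mult_closed st_closed by blast
    show "s (fstar x * x) = (s x)\<^sup>2"
    proof (rule antisym)
      show "s (fstar x * x) \<le> (s x)\<^sup>2"
      proof (rule univ_seminorm_le)
        fix p assume p: "cstar_seminorm G R p"
        interpret P: cstar_seminormed_algebra F fscale fstar p
          using p by (rule cstar_seminormed_algebraI)
        show "p (fstar x * x) \<le> (s x)\<^sup>2"
          using P.p_cstar[OF x] seminorm_le_univ[OF x p] P.p_nonneg[OF x] by (simp add: power_mono)
      qed
      \<comment> \<open>With the root on the other side, the supremum is over plain values p x and
        \<open>univ_seminorm_le\<close> can bound it.\<close>
      have "s x \<le> sqrt (s (fstar x * x))"
      proof (rule univ_seminorm_le)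
        fix p assume p: "cstar_seminorm G R p"
        show "p x \<le> sqrt (s (fstar x * x))"
          using cstar_seminormed_algebra.p_cstar[OF cstar_seminormed_algebraI[OF p] x]
            seminorm_le_univ[OF xx p] by (auto intro: real_le_rsqrt)
      qed
      then show "(s x)\<^sup>2 \<le> s (fstar x * x)"
        using univ_seminorm_nonneg[OF x] univ_seminorm_nonneg[OF xx]
        by (metis power_mono real_sqrt_pow2)
    qed
  qed
  show "cstar_seminormed_algebra.cauchy_seqs F s = univ_cauchy G R"
    by (simp add: cstar_seminormed_algebra.cauchy_seqs_def[OF *] univ_cauchy_def)
qed

abbreviation "K \<equiv> univ_cauchy G R"
abbreviation "cls \<equiv> univ_class G R"
abbreviation "A \<equiv> univ_cstar G R"

sublocale KA: star_algebra K "\<lambda>c x n. fscale c (x n)" "\<lambda>x n. fstar (x n)"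
  by (rule star_algebra_cauchy_seqs)

section \<open>The quotient by null sequences\<close>

lemma univ_rel_iff:
  "(x, y) \<in> univ_rel G R \<longleftrightarrow> x \<in> K \<and> y \<in> K \<and> (\<lambda>n. s ((x - y) n)) \<longlonglongrightarrow> 0"
  by (simp add: univ_rel_def)

lemma null_add:
  assumes "x \<in> K" "y \<in> K" "(\<lambda>n. s (x n)) \<longlonglongrightarrow> 0" "(\<lambda>n. s (y n)) \<longlonglongrightarrow> 0"
  shows "(\<lambda>n. s ((x + y) n)) \<longlonglongrightarrow> 0"
proof (rule tendsto_sandwich[of "\<lambda>_. 0" _ _ "\<lambda>n. s (x n) + s (y n)"])
  show "(\<lambda>n. s (x n) + s (y n)) \<longlonglongrightarrow> 0" using tendsto_add[OF assms(3,4)] by simp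
  show "\<forall>\<^sub>F n in sequentially. 0 \<le> s ((x + y) n)"
    using p_nonneg[OF cauchy_seqs_closed[OF cauchy_seqs_add[OF assms(1,2)]]] by simp
  show "\<forall>\<^sub>F n in sequentially. s ((x + y) n) \<le> s (x n) + s (y n)"
    using p_add[OF cauchy_seqs_closed[OF assms(1)] cauchy_seqs_closed[OF assms(2)]] by simp
qed simp

text \<open>The seminorms of both factors converge and one limit is 0, so their product tends to 0:
  null sequences form an ideal.\<close>

lemma null_mult:
  assumes x: "x \<in> K" and y: "y \<in> K"
    and null: "(\<lambda>n. s (x n)) \<longlonglongrightarrow> 0 \<or> (\<lambda>n. s (y n)) \<longlonglongrightarrow> 0"
  shows "(\<lambda>n. s ((x * y) n)) \<longlonglongrightarrow> 0"
proof (rule tendsto_sandwich[of "\<lambda>_. 0" _ _ "\<lambda>n. s (x n) * s (y n)"])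
  obtain a b where "(\<lambda>n. s (x n)) \<longlonglongrightarrow> a" "(\<lambda>n. s (y n)) \<longlonglongrightarrow> b"
    using cauchy_seqs_convergent x y unfolding convergent_def by blast
  moreover from this null have "a = 0 \<or> b = 0" using LIMSEQ_unique by metis
  ultimately show "(\<lambda>n. s (x n) * s (y n)) \<longlonglongrightarrow> 0"
    using tendsto_mult by fastforce
  show "\<forall>\<^sub>F n in sequentially. 0 \<le> s ((x * y) n)"
    using p_nonneg[OF cauchy_seqs_closed[OF cauchy_seqs_mult[OF x y]]] by simp
  show "\<forall>\<^sub>F n in sequentially. s ((x * y) n) \<le> s (x n) * s (y n)"
    using p_mult[OF cauchy_seqs_closed[OF x] cauchy_seqs_closed[OF y]] by simp
qed simp

lemma equiv_univ_rel: "equiv K (univ_rel G R)"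
proof (rule equivI)
  show "univ_rel G R \<subseteq> K \<times> K" by (auto simp: univ_rel_def)
  show "refl_on K (univ_rel G R)"
    by (auto simp: refl_on_def univ_rel_iff p_zero)
  show "sym (univ_rel G R)"
    using p_diff_commute cauchy_seqs_closed by (fastforce simp: univ_rel_iff intro: symI)
  show "trans (univ_rel G R)"
  proof (rule transI)
    fix x y z assume "(x, y) \<in> univ_rel G R" "(y, z) \<in> univ_rel G R"
    then show "(x, z) \<in> univ_rel G R"
      using null_add[of "x - y" "y - z"] KA.diff_closed by (simp add: univ_rel_iff)
  qed
qed

lemma cls_eq_iff: "x \<in> K \<Longrightarrow> y \<in> K \<Longrightarrow> cls x = cls y \<longleftrightarrow> (\<lambda>n. s ((x - y) n)) \<longlonglongrightarrow> 0"
  unfolding univ_class_def by (simp add: eq_equiv_class_iff[OF equiv_univ_rel] univ_rel_iff)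

lemma carrier_eq: "cs_carrier A = cls ` K"
  by (auto simp: univ_cstar_def quotient_def univ_class_def)

lemma carrierE:
  assumes "X \<in> cs_carrier A"
  obtains x where "x \<in> K" "X = cls x"
  using assms carrier_eq by auto

lemma cls_in_carrier: "x \<in> K \<Longrightarrow> cls x \<in> cs_carrier A"
  by (simp add: carrier_eq)

text \<open>The operations of \<open>univ_cstar\<close> are unions over all representatives;
  congruence makes every member of the union the same class. The next three operations follow this
  scheme.\<close>

lemma cs_add_cls:
  assumes "x \<in> K" "y \<in> K"
  shows "cs_add A (cls x) (cls y) = cls (x + y)"
proof -
  have "congruent2 (univ_rel G R) (univ_rel G R) (\<lambda>x y. cls (\<lambda>n. x n + y n))"
  proof (rule congruent2I')
    fix x x' y y' assume "(x, x') \<in> univ_rel G R" "(y, y') \<in> univ_rel G R"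
    then have K: "x \<in> K" "x' \<in> K" "y \<in> K" "y' \<in> K"
      and "(\<lambda>n. s (((x - x') + (y - y')) n)) \<longlonglongrightarrow> 0"
      using null_add[of "x - x'" "y - y'"] KA.diff_closed
      by (auto simp: univ_rel_iff simp del: minus_apply plus_fun_apply)
    moreover have "(x - x') + (y - y') = (x + y) - (x' + y')" by (simp add: algebra_simps)
    ultimately have "cls (x + y) = cls (x' + y')"
      by (simp only: cls_eq_iff KA.add_closed)
    then show "cls (\<lambda>n. x n + y n) = cls (\<lambda>n. x' n + y' n)" by (simp only: plus_fun_def)
  qed
  from UN_equiv_class2[OF equiv_univ_rel equiv_univ_rel this assms] show ?thesis
    by (simp add: univ_cstar_def univ_class_def plus_fun_def)
qed

lemma cs_mult_cls:
  assumes "x \<in> K" "y \<in> K"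
  shows "cs_mult A (cls x) (cls y) = cls (x * y)"
proof -
  have "congruent2 (univ_rel G R) (univ_rel G R) (\<lambda>x y. cls (\<lambda>n. x n * y n))"
  proof (rule congruent2I')
    fix x x' y y' assume "(x, x') \<in> univ_rel G R" "(y, y') \<in> univ_rel G R"
    then have K: "x \<in> K" "x' \<in> K" "y \<in> K" "y' \<in> K"
      and "(\<lambda>n. s (((x - x') * y + x' * (y - y')) n)) \<longlonglongrightarrow> 0"
      using null_add[OF _ _ null_mult null_mult, of "x - x'" y x' "y - y'"]
      by (auto simp: univ_rel_iff KA.diff_closed KA.mult_closed
          simp del: minus_apply plus_fun_apply times_fun_apply)
    \<comment> \<open>The representatives are exchanged one at a time, so that each summand has a
      null factor.\<close>
    moreover have "(x - x') * y + x' * (y - y') = x * y - x' * y'" by (simp add: algebra_simps)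
    ultimately have "cls (x * y) = cls (x' * y')"
      by (simp only: cls_eq_iff KA.mult_closed)
    then show "cls (\<lambda>n. x n * y n) = cls (\<lambda>n. x' n * y' n)" by (simp only: times_fun_def)
  qed
  from UN_equiv_class2[OF equiv_univ_rel equiv_univ_rel this assms] show ?thesis
    by (simp add: univ_cstar_def univ_class_def times_fun_def)
qed

lemma cs_scale_cls:
  assumes "x \<in> K"
  shows "cs_scale A c (cls x) = cls (\<lambda>n. fscale c (x n))"
proof -
  have "congruent (univ_rel G R) (\<lambda>x. cls (\<lambda>n. fscale c (x n)))"
  proof (rule congruentI)
    fix x x' assume "(x, x') \<in> univ_rel G R"
    then have K: "x \<in> K" "x' \<in> K" and "(\<lambda>n. s (x n - x' n)) \<longlonglongrightarrow> 0"
      by (auto simp: univ_rel_iff)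
    then have "(\<lambda>n. s (fscale c (x n - x' n))) \<longlonglongrightarrow> 0"
      by (simp add: p_sc diff_closed cauchy_seqs_closed tendsto_mult_right_zero)
    then show "cls (\<lambda>n. fscale c (x n)) = cls (\<lambda>n. fscale c (x' n))"
      using K by (simp add: cls_eq_iff cauchy_seqs_sc sc_diff_right)
  qed
  from UN_equiv_class[OF equiv_univ_rel this assms] show ?thesis
    by (simp add: univ_cstar_def univ_class_def)
qed

lemma cs_star_cls:
  assumes "x \<in> K"
  shows "cs_star A (cls x) = cls (\<lambda>n. fstar (x n))"
proof -
  have "congruent (univ_rel G R) (\<lambda>x. cls (\<lambda>n. fstar (x n)))"
  proof (rule congruentI)
    fix x x' assume "(x, x') \<in> univ_rel G R"
    then have K: "x \<in> K" "x' \<in> K" and "(\<lambda>n. s (x n - x' n)) \<longlonglongrightarrow> 0"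
      by (auto simp: univ_rel_iff)
    then have "(\<lambda>n. s (fstar (x n - x' n))) \<longlonglongrightarrow> 0"
      by (simp add: p_st diff_closed cauchy_seqs_closed)
    then show "cls (\<lambda>n. fstar (x n)) = cls (\<lambda>n. fstar (x' n))"
      using K by (simp add: cls_eq_iff cauchy_seqs_st st_diff)
  qed
  from UN_equiv_class[OF equiv_univ_rel this assms] show ?thesis
    by (simp add: univ_cstar_def univ_class_def)
qed

lemma carrier_closed:
  assumes "X \<in> cs_carrier A" "Y \<in> cs_carrier A"
  shows "cs_add A X Y \<in> cs_carrier A" "cs_mult A X Y \<in> cs_carrier A"
    "cs_scale A c X \<in> cs_carrier A" "cs_star A X \<in> cs_carrier A"
  using assms
  by (auto elim!: carrierE intro!: cls_in_carrier KA.add_closed KA.mult_closed KA.sc_closed KA.st_closed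
      simp: cs_add_cls cs_mult_cls cs_scale_cls cs_star_cls simp del: plus_fun_apply times_fun_apply)

text \<open>\<open>cs_norm\<close> is \<open>the_elem\<close> of the set of limits along
  representatives, so these must agree and the class must be nonempty. In the form of a convergence,
  the norm laws follow by passing to the limit.\<close>

lemma cs_norm_cls:
  assumes x: "x \<in> K"
  shows "(\<lambda>n. s (x n)) \<longlonglongrightarrow> cs_norm A (cls x)"
proof -
  obtain l where l: "(\<lambda>n. s (x n)) \<longlonglongrightarrow> l"
    using cauchy_seqs_convergent[OF x] by (auto simp: convergent_def)
  have "lim (\<lambda>n. s (y n)) = l" if "(x, y) \<in> univ_rel G R" for y
  proof -
    have y: "y \<in> K" and null: "(\<lambda>n. s ((x - y) n)) \<longlonglongrightarrow> 0" using that by (auto simp: univ_rel_iff)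
    have "norm (s (x n) - s (y n)) \<le> norm (s ((x - y) n)) * 1" for n
      using abs_p_diff[OF cauchy_seqs_closed[OF x] cauchy_seqs_closed[OF y], of n n] by simp
    then have "(\<lambda>n. s (x n) - s (y n)) \<longlonglongrightarrow> 0"
      by (intro tendsto_0_le[OF null] always_eventually allI)
    from tendsto_diff[OF l this] show ?thesis by (simp add: limI)
  qed
  moreover have "x \<in> cls x" 
    unfolding univ_class_def by (rule equiv_class_self[OF equiv_univ_rel x])
  ultimately have "(\<lambda>x. lim (\<lambda>n. s (x n))) ` cls x = {l}"
    unfolding univ_class_def by fastforce
  then show ?thesis using l by (simp add: univ_cstar_def)
qed

lemma cs_norm_diff_cls:
  "x \<in> K \<Longrightarrow> y \<in> K \<Longrightarrow> cs_norm A (cls (x - y)) = 0 \<Longrightarrow> cls x = cls y"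
  using cs_norm_cls[of "x - y"] by (simp add: cls_eq_iff KA.diff_closed)

section \<open>The C*-norm on the quotient\<close>

lemma cs_norm_add:
  assumes "X \<in> cs_carrier A" "Y \<in> cs_carrier A"
  shows "cs_norm A (cs_add A X Y) \<le> cs_norm A X + cs_norm A Y"
proof -
  obtain x where x: "x \<in> K" "X = cls x" using assms(1) by (rule carrierE)
  obtain y where y: "y \<in> K" "Y = cls y" using assms(2) by (rule carrierE)
  note xy = x y
  have "(\<lambda>n. s (x n + y n)) \<longlonglongrightarrow> cs_norm A (cls (x + y))"
    using cs_norm_cls[OF KA.add_closed] xy by simp
  moreover have "(\<lambda>n. s (x n) + s (y n)) \<longlonglongrightarrow> cs_norm A X + cs_norm A Y"
    using cs_norm_cls xy by (intro tendsto_add) auto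
  ultimately show ?thesis
    using xy p_add[OF cauchy_seqs_closed cauchy_seqs_closed]
    by (auto intro!: LIMSEQ_le simp: cs_add_cls simp del: plus_fun_apply)
qed

lemma cs_norm_mult:
  assumes "X \<in> cs_carrier A" "Y \<in> cs_carrier A"
  shows "cs_norm A (cs_mult A X Y) \<le> cs_norm A X * cs_norm A Y"
proof -
  obtain x where x: "x \<in> K" "X = cls x" using assms(1) by (rule carrierE)
  obtain y where y: "y \<in> K" "Y = cls y" using assms(2) by (rule carrierE)
  note xy = x y
  have "(\<lambda>n. s (x n * y n)) \<longlonglongrightarrow> cs_norm A (cls (x * y))"
    using cs_norm_cls[OF KA.mult_closed] xy by simp
  moreover have "(\<lambda>n. s (x n) * s (y n)) \<longlonglongrightarrow> cs_norm A X * cs_norm A Y"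
    using cs_norm_cls xy by (intro tendsto_mult) auto
  ultimately show ?thesis
    using xy p_mult[OF cauchy_seqs_closed cauchy_seqs_closed]
    by (auto intro!: LIMSEQ_le simp: cs_mult_cls simp del: times_fun_apply)
qed

lemma cs_norm_nonneg:
  assumes "X \<in> cs_carrier A"
  shows "0 \<le> cs_norm A X"
proof -
  obtain x where x: "x \<in> K" "X = cls x" using assms by (rule carrierE)
  then show ?thesis
    using LIMSEQ_le_const[OF cs_norm_cls] p_nonneg[OF cauchy_seqs_closed] by blast
qed

lemma cs_norm_scale:
  assumes "X \<in> cs_carrier A"
  shows "cs_norm A (cs_scale A c X) = cmod c * cs_norm A X"
proof -
  obtain x where x: "x \<in> K" "X = cls x" using assms by (rule carrierE)
  have "(\<lambda>n. cmod c * s (x n)) \<longlonglongrightarrow> cs_norm A (cs_scale A c X)"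
    using cs_norm_cls[OF KA.sc_closed] x p_sc cauchy_seqs_closed by (simp add: cs_scale_cls)
  moreover have "(\<lambda>n. cmod c * s (x n)) \<longlonglongrightarrow> cmod c * cs_norm A X"
    using cs_norm_cls x by (intro tendsto_mult_left) auto
  ultimately show ?thesis by (rule LIMSEQ_unique)
qed

lemma cs_norm_cstar:
  assumes "X \<in> cs_carrier A"
  shows "cs_norm A (cs_mult A (cs_star A X) X) = (cs_norm A X)\<^sup>2"
proof -
  obtain x where x: "x \<in> K" "X = cls x" using assms by (rule carrierE)
  have "(\<lambda>n. (s (x n))\<^sup>2) \<longlonglongrightarrow> cs_norm A (cls ((\<lambda>n. fstar (x n)) * x))"
    using cs_norm_cls[OF KA.mult_closed[OF KA.st_closed[OF x(1)] x(1)]] x p_cstar cauchy_seqs_closed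
    by simp
  moreover have "(\<lambda>n. (s (x n))\<^sup>2) \<longlonglongrightarrow> (cs_norm A X)\<^sup>2"
    using cs_norm_cls x by (intro tendsto_power) auto
  ultimately show ?thesis
    using x LIMSEQ_unique by (auto simp: cs_star_cls cs_mult_cls KA.st_closed simp del: times_fun_apply)
qed

end

section \<open>Star homomorphisms between universal C*-algebras\<close>

context bounded_relations
begin

lemma cs_diff_cls:
  "x \<in> K \<Longrightarrow> y \<in> K \<Longrightarrow> cs_add A (cls x) (cs_scale A (- 1) (cls y)) = cls (x - y)"
proof -
  assume "x \<in> K" "y \<in> K"
  moreover have "x + (\<lambda>n. fscale (- 1) (y n)) = x - y"
    by (rule ext) (simp add: sc_minus_left sc_one)
  ultimately show ?thesis by (simp only: cs_scale_cls cs_add_cls KA.sc_closed)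
qed

text \<open>The record has no subtraction, hence the scalar -1. Both distances on the right end at
  \<open>Y\<close>, so that estimates for two homomorphisms against a common value fit without a
  symmetry law.\<close>

lemma cs_dist_triangle:
  assumes "X \<in> cs_carrier A" "Y \<in> cs_carrier A" "Z \<in> cs_carrier A"
  shows "cs_norm A (cs_add A X (cs_scale A (- 1) Z))
    \<le> cs_norm A (cs_add A X (cs_scale A (- 1) Y)) + cs_norm A (cs_add A Z (cs_scale A (- 1) Y))"
proof -
  obtain x where x: "x \<in> K" "X = cls x" using assms(1) by (rule carrierE)
  obtain y where y: "y \<in> K" "Y = cls y" using assms(2) by (rule carrierE)
  obtain z where z: "z \<in> K" "Z = cls z" using assms(3) by (rule carrierE)
  have "x - z = (x - y) - (z - y)" by simp
  then have "cs_add A X (cs_scale A (- 1) Z) =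
      cs_add A (cls (x - y)) (cs_scale A (- 1) (cls (z - y)))"
    using x y z by (simp only: cs_diff_cls KA.diff_closed)
  moreover have "cls (x - y) \<in> cs_carrier A" "cls (z - y) \<in> cs_carrier A"
    using x y z by (auto intro!: cls_in_carrier KA.diff_closed)
  ultimately show ?thesis
    using x y z cs_norm_add[of "cls (x - y)" "cs_scale A (- 1) (cls (z - y))"]
    by (simp only: cs_diff_cls carrier_closed cs_norm_scale) simp
qed

lemma eq_if_cs_dist_zero:
  assumes "X \<in> cs_carrier A" "Y \<in> cs_carrier A" "cs_norm A (cs_add A X (cs_scale A (- 1) Y)) = 0"
  shows "X = Y"
proof -
  obtain x where x: "x \<in> K" "X = cls x" using assms(1) by (rule carrierE)
  obtain y where y: "y \<in> K" "Y = cls y" using assms(2) by (rule carrierE)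
  show ?thesis
    using assms(3) x y cs_norm_diff_cls by (simp only: cs_diff_cls)
qed

abbreviation "const a \<equiv> cls (\<lambda>_. a)"

lemma const_in_carrier: "a \<in> F \<Longrightarrow> const a \<in> cs_carrier A"
  by (intro cls_in_carrier cauchy_seqs_const)

lemma const_eq_iff: "a \<in> F \<Longrightarrow> b \<in> F \<Longrightarrow> const a = const b \<longleftrightarrow> s (a - b) = 0"
  by (simp add: cls_eq_iff cauchy_seqs_const LIMSEQ_const_iff)

lemma const_add: "a \<in> F \<Longrightarrow> b \<in> F \<Longrightarrow> const (a + b) = cs_add A (const a) (const b)"
  by (simp only: cs_add_cls cauchy_seqs_const) (simp only: plus_fun_def)

lemma const_mult: "a \<in> F \<Longrightarrow> b \<in> F \<Longrightarrow> const (a * b) = cs_mult A (const a) (const b)"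
  by (simp only: cs_mult_cls cauchy_seqs_const) (simp only: times_fun_def)

lemma const_scale: "a \<in> F \<Longrightarrow> const (fscale c a) = cs_scale A c (const a)"
  by (simp only: cs_scale_cls cauchy_seqs_const)

lemma const_star: "a \<in> F \<Longrightarrow> const (fstar a) = cs_star A (const a)"
  by (simp only: cs_star_cls cauchy_seqs_const)

end

section \<open>Contractivity and uniqueness of star homomorphisms\<close>

locale star_hom_univ = A: bounded_relations G R + B: bounded_relations H Q
  for G :: "'g set" and R and H :: "'h set" and Q +
  fixes f
  assumes hom: "star_hom (univ_cstar G R) (univ_cstar H Q) f"
begin

lemma f_closed: "X \<in> cs_carrier A.A \<Longrightarrow> f X \<in> cs_carrier B.A"
  using hom by (auto simp: star_hom_def)

lemma f_add: "X \<in> cs_carrier A.A \<Longrightarrow> Y \<in> cs_carrier A.A \<Longrightarrow> f (cs_add A.A X Y) = cs_add B.A (f X) (f Y)"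
  and f_mult: "X \<in> cs_carrier A.A \<Longrightarrow> Y \<in> cs_carrier A.A \<Longrightarrow> f (cs_mult A.A X Y) = cs_mult B.A (f X) (f Y)"
  and f_scale: "X \<in> cs_carrier A.A \<Longrightarrow> f (cs_scale A.A c X) = cs_scale B.A c (f X)"
  and f_star: "X \<in> cs_carrier A.A \<Longrightarrow> f (cs_star A.A X) = cs_star B.A (f X)"
  using hom by (auto simp: star_hom_def)

text \<open>Pulling the norm back to representatives keeps the argument in a ring type; the result
  is the \<open>q\<close> for \<open>cstar_seminorm_on_cauchy_seqs_contractive\<close>.\<close>

lemma cstar_seminorm_norm_hom:
  "cstar_seminormed_algebra A.K (\<lambda>c x n. fscale c (x n)) (\<lambda>x n. fstar (x n))
    (\<lambda>x. cs_norm B.A (f (A.cls x)))"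
proof (intro cstar_seminormed_algebra.intro A.star_algebra_cauchy_seqs
    cstar_seminormed_algebra_axioms.intro)
  fix x y assume x: "x \<in> A.K" and y: "y \<in> A.K"
  note carr = A.cls_in_carrier[OF x] A.cls_in_carrier[OF y]
  show "cs_norm B.A (f (A.cls (x + y))) \<le> cs_norm B.A (f (A.cls x)) + cs_norm B.A (f (A.cls y))"
    using B.cs_norm_add[OF carr[THEN f_closed]] carr x y
    by (simp only: A.cs_add_cls[symmetric] f_add)
  show "cs_norm B.A (f (A.cls (x * y))) \<le> cs_norm B.A (f (A.cls x)) * cs_norm B.A (f (A.cls y))"
    using B.cs_norm_mult[OF carr[THEN f_closed]] carr x y
    by (simp only: A.cs_mult_cls[symmetric] f_mult)
next
  fix x assume x: "x \<in> A.K"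
  note carr = A.cls_in_carrier[OF x]
  show "0 \<le> cs_norm B.A (f (A.cls x))"
    using B.cs_norm_nonneg[OF f_closed[OF carr]] .
  show "cs_norm B.A (f (A.cls (\<lambda>n. fscale c (x n)))) = cmod c * cs_norm B.A (f (A.cls x))" for c
    using B.cs_norm_scale[OF f_closed[OF carr]] carr x
    by (simp only: A.cs_scale_cls[symmetric] f_scale)
  show "cs_norm B.A (f (A.cls ((\<lambda>n. fstar (x n)) * x))) = (cs_norm B.A (f (A.cls x)))\<^sup>2"
    using B.cs_norm_cstar[OF f_closed[OF carr]] carr x A.carrier_closed[OF carr carr]
    by (simp only: A.cs_mult_cls[symmetric] A.cs_star_cls[symmetric] A.KA.st_closed f_mult f_star)
qed

lemma norm_hom_le:
  assumes x: "x \<in> A.K" and le: "\<And>n. N \<le> n \<Longrightarrow> A.s (x n) \<le> \<rho>" and "\<rho> < \<delta>"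
  shows "cs_norm B.A (f (A.cls x)) \<le> \<delta>"
proof (rule A.cstar_seminorm_on_cauchy_seqs_contractive[OF cstar_seminorm_norm_hom _ assms])
  fix y assume y: "y \<in> A.K" and null: "(\<lambda>n. A.s (y n)) \<longlonglongrightarrow> 0"
  note carr = A.cls_in_carrier[OF y]
  \<comment> \<open>A null class equals its own 0-multiple, and homogeneity carries this through
    \<open>f\<close>.\<close>
  have "A.cls y = cs_scale A.A 0 (A.cls y)"
    using y null
    by (simp add: A.cs_scale_cls A.cls_eq_iff A.sc_zero_left A.cauchy_seqs_const A.zero_closed)
  then have "f (A.cls y) = cs_scale B.A 0 (f (A.cls y))"
    using f_scale[OF carr] by metis
  then show "cs_norm B.A (f (A.cls y)) = 0"
    using B.cs_norm_scale[OF f_closed[OF carr], of 0] by simp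
qed

end

text \<open>Agreement on generators passes to constants by \<open>free_star_alg_induct\<close>. A
  constant \<open>x N\<close> approximates \<open>X\<close>, and contractivity carries the
  approximation through both maps, so f X and g X are at distance 0.\<close>

lemma star_hom_eqI:
  assumes bounded: "bounded_relations G R" "bounded_relations H Q"
    and hom: "star_hom (univ_cstar G R) (univ_cstar H Q) f" "star_hom (univ_cstar G R) (univ_cstar H Q) g"
    and gen: "\<And>a. a \<in> G \<Longrightarrow> f (univ_gen G R a) = g (univ_gen G R a)"
    and X: "X \<in> cs_carrier (univ_cstar G R)"
  shows "f X = g X"
proof -
  interpret A: bounded_relations G R by fact
  interpret B: bounded_relations H Q by fact
  interpret f: star_hom_univ G R H Q f by unfold_locales (rule hom)
  interpret g: star_hom_univ G R H Q g by unfold_locales (rule hom)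
  have const: "f (A.const a) = g (A.const a)" if "a \<in> A.F" for a
    using that
  proof (induction a rule: free_star_alg_induct)
    case zero
    \<comment> \<open>The record has no zero field, so f and g are compared at 0 through the norm:
      both images are 0-multiples of themselves.\<close>
    have "A.const 0 = cs_scale A.A 0 (A.const 0)"
      using A.const_scale[OF A.zero_closed, of 0] by (simp add: A.sc_zero_left)
    then have *: "h (A.const 0) = cs_scale B.A 0 (h (A.const 0))"
      if "star_hom_univ G R H Q h" for h
      using star_hom_univ.f_scale[OF that A.const_in_carrier[OF A.zero_closed], of 0] by simp
    have "cs_norm B.A (cs_add B.A (f (A.const 0)) (cs_scale B.A (- 1) (g (A.const 0)))) = 0"
    proof -
      have c: "f (A.const 0) \<in> cs_carrier B.A" "g (A.const 0) \<in> cs_carrier B.A"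
        using f.f_closed g.f_closed A.const_in_carrier[OF A.zero_closed] by auto
      have "cs_norm B.A (f (A.const 0)) = 0"
        using *[OF f.star_hom_univ_axioms] B.cs_norm_scale[OF c(1), of 0] by simp
      moreover have "cs_norm B.A (g (A.const 0)) = 0"
        using *[OF g.star_hom_univ_axioms] B.cs_norm_scale[OF c(2), of 0] by simp
      ultimately show ?thesis
        using B.cs_norm_add[OF c(1) B.carrier_closed(3)[OF c(2) c(2)], of "- 1"]
          B.cs_norm_scale[OF c(2), of "- 1"]
          B.cs_norm_nonneg[OF B.carrier_closed(1)[OF c(1) B.carrier_closed(3)[OF c(2) c(2)]], of "- 1"]
        by simp
    qed
    then show ?case
      using B.eq_if_cs_dist_zero f.f_closed g.f_closed A.const_in_carrier[OF A.zero_closed] by blast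
  next
    case (gen a)
    then show ?case using assms(5) by (simp add: univ_gen_def)
  qed (simp_all add: A.const_add A.const_mult A.const_scale A.const_star A.const_in_carrier
      f.f_add f.f_mult f.f_scale f.f_star g.f_add g.f_mult g.f_scale g.f_star)
  obtain x where x: "x \<in> A.K" "X = A.cls x" using X by (rule A.carrierE)
  have carr: "f X \<in> cs_carrier B.A" "g X \<in> cs_carrier B.A"
    using X f.f_closed g.f_closed by auto
  let ?d = "cs_norm B.A (cs_add B.A (f X) (cs_scale B.A (- 1) (g X)))"
  have "?d \<le> \<epsilon>" if "0 < \<epsilon>" for \<epsilon>
  proof -
    \<comment> \<open>\<open>norm_hom_le\<close> needs a bound strictly below its conclusion:
      \<epsilon>/4 along the sequence gives \<epsilon>/2 for each of f and g.\<close>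
    have "0 < \<epsilon> / 4" using that by simp
    then obtain N where N: "\<And>n. n \<ge> N \<Longrightarrow> A.s (x n - x N) < \<epsilon> / 4"
      using A.cauchy_seqsD[OF x(1)] by blast
    have c: "(\<lambda>_. x N) \<in> A.K" "A.const (x N) \<in> cs_carrier A.A"
      using A.cauchy_seqs_closed[OF x(1)] A.cauchy_seqs_const A.const_in_carrier by auto
    have near: "cs_norm B.A (cs_add B.A (h X) (cs_scale B.A (- 1) (h (A.const (x N))))) \<le> \<epsilon> / 2"
      if h: "star_hom_univ G R H Q h" for h
    proof -
      have "cs_norm B.A (h (A.cls (x - (\<lambda>_. x N)))) \<le> \<epsilon> / 2"
        using N \<open>0 < \<epsilon>\<close> x c
        by (intro star_hom_univ.norm_hom_le[OF h, of _ N "\<epsilon> / 4"]) (auto intro: A.KA.diff_closed less_imp_le)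
      then show ?thesis
        using x c X A.carrier_closed
        by (simp only: A.cs_diff_cls[symmetric] star_hom_univ.f_add[OF h] star_hom_univ.f_scale[OF h])
    qed
    show ?thesis
      using B.cs_dist_triangle[OF carr(1) f.f_closed[OF c(2)] carr(2)]
        near[OF f.star_hom_univ_axioms] near[OF g.star_hom_univ_axioms]
        const[OF A.cauchy_seqs_closed[OF x(1)]] by simp
  qed
  then have "?d \<le> 0" by (rule field_le_epsilon[of ?d 0, simplified])
  moreover have "0 \<le> ?d"
    using carr by (intro B.cs_norm_nonneg B.carrier_closed)
  ultimately show ?thesis using B.eq_if_cs_dist_zero[OF carr] by simp
qed

lemma star_hom_inv_into:
  assumes bounded: "bounded_relations G R"
    and iso: "star_iso (univ_cstar G R) B f"
  shows "star_hom B (univ_cstar G R) (inv_into (cs_carrier (univ_cstar G R)) f)"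
proof -
  interpret A: bounded_relations G R by fact
  let ?g = "inv_into (cs_carrier A.A) f"
  have bij: "bij_betw f (cs_carrier A.A) (cs_carrier B)" and hom: "star_hom A.A B f"
    using iso by (auto simp: star_iso_def)
  have g: "?g y \<in> cs_carrier A.A" "f (?g y) = y" if "y \<in> cs_carrier B" for y
    using bij that by (auto simp: bij_betw_def inv_into_into f_inv_into_f)
  have g_eq: "?g (f x) = x" if "x \<in> cs_carrier A.A" for x
    using bij that by (simp add: bij_betw_def)
  show ?thesis
    unfolding star_hom_def
  proof (intro conjI ballI allI)
    fix x y assume xy: "x \<in> cs_carrier B" "y \<in> cs_carrier B"
    show "?g (cs_add B x y) = cs_add A.A (?g x) (?g y)"
      using hom g[OF xy(1)] g[OF xy(2)] A.carrier_closed(1) g_eq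
      unfolding star_hom_def by metis
    show "?g (cs_mult B x y) = cs_mult A.A (?g x) (?g y)"
      using hom g[OF xy(1)] g[OF xy(2)] A.carrier_closed(2) g_eq
      unfolding star_hom_def by metis
  next
    fix x c assume x: "x \<in> cs_carrier B"
    show "?g (cs_scale B c x) = cs_scale A.A c (?g x)"
      using hom g[OF x] A.carrier_closed(3) g_eq unfolding star_hom_def by metis
  next
    fix x assume x: "x \<in> cs_carrier B"
    show "?g (cs_star B x) = cs_star A.A (?g x)"
      using hom g[OF x] A.carrier_closed(4) g_eq unfolding star_hom_def by metis
  qed (use g in auto)
qed

section \<open>Cuntz-Krieger relations\<close>

lemma ck_gens_vert: "v \<in> verts E \<Longrightarrow> gen (Inl v) \<in> free_star_alg (ck_gens E)"
  and ck_gens_arc: "a \<in> arcs E \<Longrightarrow> gen (Inr a) \<in> free_star_alg (ck_gens E)"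
  by (auto simp: ck_gens_def intro!: free_star_alg_gen)

lemma ck_rels_vert_idem: "v \<in> verts E \<Longrightarrow> gen (Inl v) * gen (Inl v) - gen (Inl v) \<in> ck_rels E"
  and ck_rels_vert_star: "v \<in> verts E \<Longrightarrow> fstar (gen (Inl v)) - gen (Inl v) \<in> ck_rels E"
  and ck_rels_arc: "a \<in> arcs E \<Longrightarrow>
    fstar (gen (Inr a)) * gen (Inr a) - gen (Inl (head E a)) \<in> ck_rels E"
  by (auto simp: ck_rels_def)

lemma ck_rels_single_out_arc:
  assumes "w \<in> verts E" "out_arcs E w = {a}"
  shows "gen (Inl w) - gen (Inr a) * fstar (gen (Inr a)) \<in> ck_rels E"
proof -
  have "w \<in> reg E" using assms by (simp add: reg_def)
  then have "gen (Inl w) - (\<Sum>a\<in>out_arcs E w. gen (Inr a) * fstar (gen (Inr a))) \<in> ck_rels E"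
    unfolding ck_rels_def by blast
  then show ?thesis using assms by simp
qed

text \<open>For a vertex, the projection relations and the C*-identity give p(S_v)^2 = p(S_v), so
  the value is 0 or 1. For an edge, the square of the value is the value at its target
  vertex.\<close>

lemma (in wf_digraph) ck_seminorm_gen_le_one:
  assumes p: "cstar_seminorm (ck_gens G) (ck_rels G) p" and g: "g \<in> ck_gens G"
  shows "p (gen g) \<le> 1"
proof -
  interpret P: cstar_seminormed_algebra "free_star_alg (ck_gens G)" fscale fstar p
    using p by (rule cstar_seminormed_algebraI)
  have rel: "p r = 0" if "r \<in> ck_rels G" for r
    using p that by (simp add: cstar_seminorm_def)
  have vert: "p (gen (Inl v)) \<le> 1" if v: "v \<in> verts G" for v
  proof -
    let ?v = "gen (Inl v) :: ('a + 'b) free_alg"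
    note F = ck_gens_vert[OF v]
    have "p (fstar ?v * ?v - ?v * ?v) = 0"
      using P.p_mult_null[OF P.diff_closed[OF P.st_closed[OF F] F] F] rel[OF ck_rels_vert_star[OF v]]
      by (simp add: left_diff_distrib)
    then have "p (fstar ?v * ?v) = p (?v * ?v)"
      using F by (intro P.p_eq_if_diff_null P.mult_closed P.st_closed)
    also have "\<dots> = p ?v"
      using F rel[OF ck_rels_vert_idem[OF v]] by (intro P.p_eq_if_diff_null P.mult_closed)
    finally have "p ?v * p ?v = p ?v" using P.p_cstar[OF F] by (simp add: power2_eq_square)
    then show ?thesis by auto
  qed
  show ?thesis
  proof (cases g)
    case (Inl v)
    then show ?thesis using g vert by (auto simp: ck_gens_def)
  next
    case (Inr a)
    then have a: "a \<in> arcs G" using g by (auto simp: ck_gens_def)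
    note F = ck_gens_arc[OF a]
    have "(p (gen (Inr a)))\<^sup>2 = p (gen (Inl (head G a)))"
      using a F rel[OF ck_rels_arc[OF a]] unfolding P.p_cstar[OF F, symmetric]
      by (intro P.p_eq_if_diff_null P.mult_closed P.st_closed ck_gens_vert head_in_verts)
    also have "\<dots> \<le> 1" using a by (intro vert head_in_verts)
    finally show ?thesis using power2_le_imp_le[of "p (gen (Inr a))" 1] Inr by simp
  qed
qed

sublocale wf_digraph \<subseteq> CK: bounded_relations "ck_gens G" "ck_rels G"
  using ck_seminorm_gen_le_one by unfold_locales blast

context wf_digraph
begin

lemma S_vert_const: "S_vert G v = CK.const (gen (Inl v))"
  and S_edge_const: "S_edge G a = CK.const (gen (Inr a))"
  by (simp_all add: S_vert_def S_edge_def univ_gen_def)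

lemma S_vert_in_carrier: "v \<in> verts G \<Longrightarrow> S_vert G v \<in> cs_carrier (graph_cstar G)"
  and S_edge_in_carrier: "a \<in> arcs G \<Longrightarrow> S_edge G a \<in> cs_carrier (graph_cstar G)"
  unfolding S_vert_const S_edge_const graph_cstar_def
  by (auto intro!: CK.const_in_carrier ck_gens_vert ck_gens_arc)

lemma graph_cs_mult_closed:
  "X \<in> cs_carrier (graph_cstar G) \<Longrightarrow> Y \<in> cs_carrier (graph_cstar G) \<Longrightarrow>
    cs_mult (graph_cstar G) X Y \<in> cs_carrier (graph_cstar G)"
  unfolding graph_cstar_def by (rule CK.carrier_closed)

lemma graph_cs_star_closed:
  "X \<in> cs_carrier (graph_cstar G) \<Longrightarrow> cs_star (graph_cstar G) X \<in> cs_carrier (graph_cstar G)"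
  unfolding graph_cstar_def by (rule CK.carrier_closed)

lemma cs_star_S_vert:
  assumes v: "v \<in> verts G"
  shows "cs_star (graph_cstar G) (S_vert G v) = S_vert G v"
proof -
  note F = ck_gens_vert[OF v]
  have "CK.const (fstar (gen (Inl v))) = CK.const (gen (Inl v))"
    using CK.univ_seminorm_rel[OF ck_rels_vert_star[OF v]] F
    by (simp only: CK.const_eq_iff CK.st_closed)
  then show ?thesis using F by (simp only: S_vert_const graph_cstar_def CK.const_star)
qed

lemma cs_mult_S_vert:
  assumes v: "v \<in> verts G"
  shows "cs_mult (graph_cstar G) (S_vert G v) (S_vert G v) = S_vert G v"
proof -
  note F = ck_gens_vert[OF v]
  have "CK.const (gen (Inl v) * gen (Inl v)) = CK.const (gen (Inl v))"
    using CK.univ_seminorm_rel[OF ck_rels_vert_idem[OF v]] F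
    by (simp only: CK.const_eq_iff CK.mult_closed)
  then show ?thesis using F by (simp only: S_vert_const graph_cstar_def CK.const_mult)
qed

text \<open>
  With \<open>d = S\<^sub>aS\<^sub>v - S\<^sub>a\<close> and \<open>v\<close> the target of \<open>a\<close>, the relations give \<open>d\<^sup>*d = 0\<close>.
\<close>

lemma cs_mult_S_edge_S_vert:
  assumes a: "a \<in> arcs G"
  shows "cs_mult (graph_cstar G) (S_edge G a) (S_vert G (head G a)) = S_edge G a"
proof -
  let ?a = "gen (Inr a) :: ('a + 'b) free_alg" and ?v = "gen (Inl (head G a)) :: ('a + 'b) free_alg"
  have v: "head G a \<in> verts G" using a by simp
  note F = ck_gens_arc[OF a] ck_gens_vert[OF v]
  note closed = CK.mult_closed CK.st_closed CK.diff_closed CK.add_closed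
  define d where "d = ?a * ?v - ?a"
  define r1 where "r1 = fstar ?a * ?a - ?v"
  define r2 where "r2 = ?v * ?v - ?v"
  have null: "CK.s r1 = 0" "CK.s r2 = 0"
    unfolding r1_def r2_def
    by (intro CK.univ_seminorm_rel ck_rels_arc[OF a] ck_rels_vert_idem[OF v])+
  have C: "r1 \<in> CK.F" "r2 \<in> CK.F" "d \<in> CK.F" unfolding r1_def r2_def d_def using F by (auto intro!: closed)
  \<comment> \<open>\<open>?k\<close> equals \<open>fstar ?a * d\<close>, written through relators
    so that its seminorm visibly vanishes.\<close>
  let ?k = "r1 * ?v - r1 + r2"
  have k: "?k \<in> CK.F" "CK.s ?k = 0"
  proof -
    show "?k \<in> CK.F" using C F by (intro closed)
    have "CK.s (r1 * ?v - r1) = 0"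
      using C F null CK.p_mult_null[of r1 ?v] CK.p_diff[of "r1 * ?v" r1]
        CK.p_nonneg[of "r1 * ?v - r1"] by (simp add: closed)
    then show "CK.s ?k = 0" using C F null by (intro CK.p_add_null closed)
  qed
  have "fstar d * d = fstar ?v * ?k - ?k"
    by (simp add: d_def r1_def r2_def CK.st_diff CK.st_mult algebra_simps)
  then have "CK.s (fstar d * d) = 0"
    using k F CK.p_mult_null[of "fstar ?v" ?k] CK.p_diff[of "fstar ?v * ?k" ?k]
      CK.p_nonneg[of "fstar d * d"] C by (simp add: closed)
  then have "CK.s d = 0" using CK.p_cstar[OF C(3)] by simp
  then have "CK.const (?a * ?v) = CK.const ?a"
    using F by (simp only: d_def CK.const_eq_iff CK.mult_closed)
  then show ?thesis
    using F by (simp only: S_vert_const S_edge_const graph_cstar_def CK.const_mult)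
qed

lemma cs_mult_S_edge_star:
  assumes w: "w \<in> verts G" and out: "out_arcs G w = {a}"
  shows "cs_mult (graph_cstar G) (S_edge G a) (cs_star (graph_cstar G) (S_edge G a)) = S_vert G w"
proof -
  have a: "a \<in> arcs G" using out in_out_arcs_conv[of a G w] by simp
  note F = ck_gens_arc[OF a] ck_gens_vert[OF w]
  have "CK.const (gen (Inl w)) = CK.const (gen (Inr a) * fstar (gen (Inr a)))"
    using CK.univ_seminorm_rel[OF ck_rels_single_out_arc[OF w out]] F
    by (simp only: CK.const_eq_iff CK.mult_closed CK.st_closed)
  then show ?thesis
    using F by (simp only: S_vert_const S_edge_const graph_cstar_def CK.const_mult CK.const_star
        CK.st_closed)
qed

lemma cs_mult_assoc:
  assumes "X \<in> cs_carrier (graph_cstar G)" "Y \<in> cs_carrier (graph_cstar G)"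
    "Z \<in> cs_carrier (graph_cstar G)"
  shows "cs_mult (graph_cstar G) (cs_mult (graph_cstar G) X Y) Z =
    cs_mult (graph_cstar G) X (cs_mult (graph_cstar G) Y Z)"
  using assms unfolding graph_cstar_def
  by (auto elim!: CK.carrierE simp: CK.cs_mult_cls CK.KA.mult_closed mult.assoc)

end

section \<open>Graph inverse semigroups\<close>

lemma path_prefix_iff: "path_prefix \<beta> \<gamma> \<longleftrightarrow> (\<exists>q. \<gamma> = (fst \<beta>, snd \<beta> @ q))"
  by (cases \<gamma>) (auto simp: path_prefix_def prefix_def)

lemma gis_mult_None_right [simp]: "gis_mult s None = None"
  by (cases s) auto

lemma path_extend_append [simp]: "path_extend \<alpha> \<beta> (u, snd \<beta> @ q) = (fst \<alpha>, snd \<alpha> @ q)"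
  by (simp add: path_extend_def)

lemma gis_mult_append_left:
  "gis_mult (Some (\<alpha>, \<beta>)) (Some ((fst \<beta>, snd \<beta> @ q), \<delta>)) = Some ((fst \<alpha>, snd \<alpha> @ q), \<delta>)"
  by (auto simp: path_prefix_iff)

lemma gis_mult_append_right:
  "gis_mult (Some (\<alpha>, (fst \<gamma>, snd \<gamma> @ q))) (Some (\<gamma>, \<delta>)) = Some (\<alpha>, (fst \<delta>, snd \<delta> @ q))"
  by (cases \<gamma>; cases \<alpha>; cases \<delta>) (auto simp: path_prefix_iff path_extend_def)

lemma gis_mult_eq_None:
  "gis_mult (Some (\<alpha>, \<beta>)) (Some (\<gamma>, \<delta>)) = None \<longleftrightarrow> \<not> path_prefix \<beta> \<gamma> \<and> \<not> path_prefix \<gamma> \<beta>"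
  by simp

lemma gis_mult_left:
  "\<gamma> = (fst \<beta>, snd \<beta> @ q) \<Longrightarrow>
    gis_mult (Some (\<alpha>, \<beta>)) (Some (\<gamma>, \<delta>)) = Some ((fst \<alpha>, snd \<alpha> @ q), \<delta>)"
  by (simp only: gis_mult_append_left)

lemma gis_mult_right:
  "\<beta> = (fst \<gamma>, snd \<gamma> @ q) \<Longrightarrow>
    gis_mult (Some (\<alpha>, \<beta>)) (Some (\<gamma>, \<delta>)) = Some (\<alpha>, (fst \<delta>, snd \<delta> @ q))"
  by (simp only: gis_mult_append_right)

lemma gis_mult_inner: "gis_mult (Some (\<alpha>, \<beta>)) (Some (\<beta>, \<gamma>)) = Some (\<alpha>, \<gamma>)"
  using gis_mult_append_left[of \<alpha> \<beta> "[]" \<gamma>] by simp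

text \<open>For nonzero x, both products of x and y are nonzero, so the paths meeting in each
  product are comparable. The remainders q and r must be empty, since the triple products return x
  and y unchanged.\<close>

lemma gis_inverse_unique:
  assumes xyx: "gis_mult (gis_mult x y) x = x" and yxy: "gis_mult (gis_mult y x) y = y"
  shows "y = gis_star x"
proof (cases x)
  case None
  with yxy show ?thesis by (cases y) auto
next
  case (Some ab)
  obtain \<alpha> \<beta> where x: "x = Some (\<alpha>, \<beta>)" using Some by (cases ab) auto
  with xyx obtain \<gamma> \<delta> where y: "y = Some (\<gamma>, \<delta>)" by (cases y) auto
  have "gis_mult x y \<noteq> None" "gis_mult y x \<noteq> None"
    using xyx yxy x y by (metis gis_mult.simps(2) option.distinct(1))+
  then have comparable: "path_prefix \<beta> \<gamma> \<or> path_prefix \<gamma> \<beta>" "path_prefix \<delta> \<alpha> \<or> path_prefix \<alpha> \<delta>"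
    unfolding x y gis_mult_eq_None by blast+
  have "\<gamma> = \<beta> \<and> \<delta> = \<alpha>"
    using comparable(1)
  proof
    assume "path_prefix \<beta> \<gamma>"
    then obtain q where q: "\<gamma> = (fst \<beta>, snd \<beta> @ q)" using path_prefix_iff by blast
    have "gis_mult (Some ((fst \<alpha>, snd \<alpha> @ q), \<delta>)) (Some (\<alpha>, \<beta>)) = Some (\<alpha>, \<beta>)"
      using xyx unfolding x y gis_mult_left[OF q] .
    note xyx' = this
    show ?thesis using comparable(2)
    proof
      assume "path_prefix \<delta> \<alpha>"
      then obtain r where r: "\<alpha> = (fst \<delta>, snd \<delta> @ r)" using path_prefix_iff by blast
      have "snd \<alpha> @ q @ r = snd \<alpha>"
        using arg_cong[OF xyx'[unfolded gis_mult_left[OF r]], of "\<lambda>z. snd (fst (the z))"] by simp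
      then show ?thesis using q r by simp
    next
      assume "path_prefix \<alpha> \<delta>"
      then obtain r where r: "\<delta> = (fst \<alpha>, snd \<alpha> @ r)" using path_prefix_iff by blast
      have "snd \<alpha> @ q = snd \<alpha>" "snd \<beta> @ r = snd \<beta>"
        using arg_cong[OF xyx'[unfolded gis_mult_right[OF r]], of "\<lambda>z. snd (fst (the z))"]
          arg_cong[OF xyx'[unfolded gis_mult_right[OF r]], of "\<lambda>z. snd (snd (the z))"] by simp_all
      then show ?thesis using q r by simp
    qed
  next
    assume "path_prefix \<gamma> \<beta>"
    then obtain q where q: "\<beta> = (fst \<gamma>, snd \<gamma> @ q)" using path_prefix_iff by blast
    show ?thesis using comparable(2)
    proof
      assume "path_prefix \<delta> \<alpha>"
      then obtain r where r: "\<alpha> = (fst \<delta>, snd \<delta> @ r)" using path_prefix_iff by blast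
      have yxy': "gis_mult (Some ((fst \<gamma>, snd \<gamma> @ r), \<beta>)) (Some (\<gamma>, \<delta>)) = Some (\<gamma>, \<delta>)"
        using yxy unfolding x y gis_mult_left[OF r] .
      have "snd \<gamma> @ r = snd \<gamma>" "snd \<delta> @ q = snd \<delta>"
        using arg_cong[OF yxy'[unfolded gis_mult_right[OF q]], of "\<lambda>z. snd (fst (the z))"]
          arg_cong[OF yxy'[unfolded gis_mult_right[OF q]], of "\<lambda>z. snd (snd (the z))"] by simp_all
      then show ?thesis using q r by simp
    next
      assume "path_prefix \<alpha> \<delta>"
      then obtain r where r: "\<delta> = (fst \<alpha>, snd \<alpha> @ r)" using path_prefix_iff by blast
      have "gis_mult (Some (\<alpha>, (fst \<delta>, snd \<delta> @ q))) (Some (\<alpha>, \<beta>)) = Some (\<alpha>, \<beta>)"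
        using xyx unfolding x y gis_mult_right[OF q] .
      moreover have "gis_mult (Some (\<alpha>, (fst \<delta>, snd \<delta> @ q))) (Some (\<alpha>, \<beta>)) =
          Some (\<alpha>, (fst \<beta>, snd \<beta> @ r @ q))"
        using r by (intro gis_mult_right) simp
      ultimately have "Some (\<alpha>, (fst \<beta>, snd \<beta> @ r @ q)) = Some (\<alpha>, \<beta>)" by simp
      then have "snd \<beta> @ r @ q = snd \<beta>" by (cases \<beta>) simp
      then show ?thesis using q r by simp
    qed
  qed
  then show ?thesis using x y by simp
qed

section \<open>The carrier of S(E) and the uniqueness of extended path homomorphisms\<close>

context wf_digraph
begin

lemma FP_iff: "\<alpha> \<in> FP G \<longleftrightarrow> awalk (fst \<alpha>) (snd \<alpha>) (path_tgt G \<alpha>)"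
  by (cases \<alpha>) (auto simp: FP_def path_tgt_def)

lemma FP_append_iff:
  "(u, p @ q) \<in> FP G \<longleftrightarrow> (u, p) \<in> FP G \<and> (path_tgt G (u, p), q) \<in> FP G"
  by (auto simp: FP_def path_tgt_def)

lemma path_tgt_append:
  "(u, p @ q) \<in> FP G \<Longrightarrow> path_tgt G (u, p @ q) = path_tgt G (path_tgt G (u, p), q)"
  by (auto simp: FP_def path_tgt_def)

lemma path_tgt_Nil [simp]: "path_tgt G (u, []) = u"
  by (simp add: path_tgt_def)

lemma path_tgt_Cons [simp]: "path_tgt G (u, a # p) = path_tgt G (head G a, p)"
  by (simp add: path_tgt_def)

lemma FP_Nil [simp]: "(u, []) \<in> FP G \<longleftrightarrow> u \<in> verts G"
  by (auto simp: FP_def awalk_Nil_iff)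

lemma FP_Cons [simp]: "(u, a # p) \<in> FP G \<longleftrightarrow> a \<in> arcs G \<and> tail G a = u \<and> (head G a, p) \<in> FP G"
  by (auto simp: FP_def awalk_Cons_iff)

lemma path_tgt_in_verts: "\<alpha> \<in> FP G \<Longrightarrow> path_tgt G \<alpha> \<in> verts G"
  using FP_iff awalk_last_in_verts by blast

lemma Some_in_gis_carrier [simp]:
  "Some (\<alpha>, \<beta>) \<in> gis_carrier G \<longleftrightarrow> \<alpha> \<in> FP G \<and> \<beta> \<in> FP G \<and> path_tgt G \<alpha> = path_tgt G \<beta>"
  unfolding gis_carrier_def by blast

lemma None_in_gis_carrier [simp]: "None \<in> gis_carrier G"
  by (simp add: gis_carrier_def)

lemma gis_mult_closed:
  assumes s: "s \<in> gis_carrier G" and t: "t \<in> gis_carrier G"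
  shows "gis_mult s t \<in> gis_carrier G"
proof (cases "gis_mult s t")
  case (Some _)
  then obtain \<alpha> \<beta> \<gamma> \<delta> where st: "s = Some (\<alpha>, \<beta>)" "t = Some (\<gamma>, \<delta>)"
    by (cases s; cases t) auto
  have "path_prefix \<beta> \<gamma> \<or> path_prefix \<gamma> \<beta>"
    using Some unfolding st by (auto split: if_splits)
  then show ?thesis
  proof
    assume "path_prefix \<beta> \<gamma>"
    then obtain q where q: "\<gamma> = (fst \<beta>, snd \<beta> @ q)" using path_prefix_iff by blast
    show ?thesis
      using s t unfolding st q gis_mult_append_left
      by (auto simp: FP_append_iff path_tgt_append)
  next
    assume "path_prefix \<gamma> \<beta>"
    then obtain q where q: "\<beta> = (fst \<gamma>, snd \<gamma> @ q)" using path_prefix_iff by blast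
    show ?thesis
      using s t unfolding st q gis_mult_append_right
      by (auto simp: FP_append_iff path_tgt_append)
  qed
qed simp

lemma ext_path_hom_mult:
  assumes "ext_path_hom G F \<phi>" "s \<in> gis_carrier G" "t \<in> gis_carrier G"
  shows "\<phi> (gis_mult s t) = gis_mult (\<phi> s) (\<phi> t)"
  using assms by (simp add: ext_path_hom_def)

text \<open>The image of the inverse satisfies the equations that characterise the inverse of the
  image.\<close>

lemma ext_path_hom_star:
  assumes \<phi>: "ext_path_hom G F \<phi>" and s: "s \<in> gis_carrier G"
  shows "\<phi> (gis_star s) = gis_star (\<phi> s)"
proof (cases s)
  case None
  then show ?thesis using \<phi> by (simp add: ext_path_hom_def)
next
  case (Some ab)
  obtain \<alpha> \<beta> where s': "s = Some (\<alpha>, \<beta>)" using Some by (cases ab) auto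
  have carr: "Some (\<alpha>, \<beta>) \<in> gis_carrier G" "Some (\<beta>, \<alpha>) \<in> gis_carrier G"
    "Some (\<alpha>, \<alpha>) \<in> gis_carrier G" "Some (\<beta>, \<beta>) \<in> gis_carrier G"
    using s s' by auto
  note mult = ext_path_hom_mult[OF \<phi>, symmetric]
  show ?thesis
    unfolding s' gis_star.simps
    by (rule gis_inverse_unique) (simp_all only: mult carr gis_mult_inner)
qed

text \<open>With v the common target, (\<alpha>,\<beta>) is (\<alpha>,v) times the inverse of
  (\<beta>,v), and (\<alpha>,v) is a product of generators, edge by edge.\<close>

lemma ext_path_hom_eqI:
  assumes \<phi>: "ext_path_hom G F \<phi>" and \<psi>: "ext_path_hom G F \<psi>"
    and gens: "extends_gens G \<phi>0 \<phi>1 \<phi>" "extends_gens G \<phi>0 \<phi>1 \<psi>"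
  shows "\<phi> = \<psi>"
proof (rule extensionalityI[where A = "gis_carrier G"])
  show "\<phi> \<in> extensional (gis_carrier G)" "\<psi> \<in> extensional (gis_carrier G)"
    using \<phi> \<psi> by (auto simp: ext_path_hom_def PiE_def)
  have path: "\<phi> (Some ((u, p), vpath (path_tgt G (u, p)))) = \<psi> (Some ((u, p), vpath (path_tgt G (u, p))))"
    if "(u, p) \<in> FP G" for u p
    using that
  proof (induction p arbitrary: u)
    case Nil
    then show ?case using gens by (simp add: extends_gens_def vpath_def)
  next
    case (Cons a p)
    let ?v = "path_tgt G (head G a, p)"
    have v: "?v \<in> verts G" using Cons.prems path_tgt_in_verts by simp
    let ?x = "Some (epath G a, vpath (head G a))" and ?y = "Some ((head G a, p), vpath ?v)"
    have eq: "Some ((u, a # p), vpath ?v) = gis_mult ?x ?y"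
      using Cons.prems gis_mult_append_left[of "epath G a" "vpath (head G a)" p "vpath ?v"]
      by (simp add: epath_def vpath_def)
    have carr: "?x \<in> gis_carrier G" "?y \<in> gis_carrier G"
      using Cons.prems v by (auto simp: epath_def vpath_def)
    have "\<phi> ?x = \<psi> ?x" "\<phi> ?y = \<psi> ?y"
      using gens Cons by (simp_all add: extends_gens_def)
    then show ?case
      unfolding path_tgt_Cons eq ext_path_hom_mult[OF \<phi> carr] ext_path_hom_mult[OF \<psi> carr]
      by (simp only:)
  qed
  fix s assume s: "s \<in> gis_carrier G"
  show "\<phi> s = \<psi> s"
  proof (cases s)
    case None
    then show ?thesis using \<phi> \<psi> by (simp add: ext_path_hom_def)
  next
    case (Some ab)
    obtain \<alpha> \<beta> where s': "s = Some (\<alpha>, \<beta>)" using Some by (cases ab) auto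
    define v :: "('a, 'b) path" where "v = vpath (path_tgt G \<beta>)"
    have carr: "Some (\<alpha>, v) \<in> gis_carrier G" "Some (\<beta>, v) \<in> gis_carrier G"
      "Some (v, \<beta>) \<in> gis_carrier G"
      using s path_tgt_in_verts unfolding s' v_def by (auto simp: vpath_def)
    have "\<phi> (Some (\<alpha>, v)) = \<psi> (Some (\<alpha>, v))" "\<phi> (Some (\<beta>, v)) = \<psi> (Some (\<beta>, v))"
      using s path[of "fst \<alpha>" "snd \<alpha>"] path[of "fst \<beta>" "snd \<beta>"] unfolding s' v_def by simp_all
    moreover from this have "\<phi> (Some (v, \<beta>)) = \<psi> (Some (v, \<beta>))"
      using ext_path_hom_star[OF \<phi> carr(2)] ext_path_hom_star[OF \<psi> carr(2)] by simp
    moreover have "s = gis_mult (Some (\<alpha>, v)) (Some (v, \<beta>))"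
      by (simp only: s' gis_mult_inner)
    ultimately show ?thesis
      using ext_path_hom_mult[OF \<phi> carr(1,3)] ext_path_hom_mult[OF \<psi> carr(1,3)] by (simp only:)
  qed
qed

end

lemma gis_le_idempotent:
  assumes "gis_le (Some (\<gamma>, \<delta>)) (Some (\<alpha>, \<alpha>))"
  shows "\<delta> = \<gamma> \<and> path_prefix \<alpha> \<gamma>"
proof -
  have *: "gis_mult (Some (\<gamma>, \<gamma>)) (Some (\<alpha>, \<alpha>)) = Some (\<gamma>, \<delta>)"
    using assms unfolding gis_le_def gis_star.simps gis_mult_inner .
  then consider "path_prefix \<gamma> \<alpha>" | "path_prefix \<alpha> \<gamma>"
    using gis_mult_eq_None by (metis option.distinct(1))
  then show ?thesis
  proof cases
    case 1
    then obtain q where q: "\<alpha> = (fst \<gamma>, snd \<gamma> @ q)" using path_prefix_iff by blast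
    have "Some ((fst \<gamma>, snd \<gamma> @ q), \<alpha>) = Some (\<gamma>, \<delta>)"
      using * unfolding gis_mult_left[OF q] .
    then have "\<alpha> = \<gamma>" "\<alpha> = \<delta>" using q by auto
    then show ?thesis by (auto simp: path_prefix_def)
  next
    case 2
    then obtain q where q: "\<gamma> = (fst \<alpha>, snd \<alpha> @ q)" using path_prefix_iff by blast
    have "Some (\<gamma>, (fst \<alpha>, snd \<alpha> @ q)) = Some (\<gamma>, \<delta>)"
      using * unfolding gis_mult_right[OF q] .
    then show ?thesis using q 2 by simp
  qed
qed

section \<open>Contracting paths\<close>

lemma (in wf_digraph) wf_digraph_unital_reduction: "wf_digraph (unital_reduction G w)"
  by standard (auto simp: unital_reduction_def)

locale reducible_vertex = wf_digraph E for E :: "('v, 'e) pre_digraph" +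
  fixes w :: 'v and e :: 'e
  assumes w: "w \<in> verts E" and out_w: "out_arcs E w = {e}" and head_e: "head E e \<noteq> w"
begin

abbreviation "ER \<equiv> unital_reduction E w"

sublocale ER: wf_digraph ER
  by (rule wf_digraph_unital_reduction)

lemma ER_simps [simp]:
  "verts ER = verts E"
  "Inl a \<in> arcs ER \<longleftrightarrow> a \<in> arcs E \<and> head E a \<noteq> w"
  "Inr (a, b) \<in> arcs ER \<longleftrightarrow> a \<in> arcs E \<and> head E a = w \<and> b = e"
  "tail ER (Inl a) = tail E a" "head ER (Inl a) = head E a"
  "tail ER (Inr (a, b)) = tail E a" "head ER (Inr (a, b)) = head E b"
  using out_w by (auto simp: unital_reduction_def simp del: in_out_arcs_conv)

lemma e [simp]: "e \<in> arcs E" "tail E e = w"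
  using out_w in_out_arcs_conv[of e E w] by auto

lemma out_w_eq: "a \<in> arcs E \<Longrightarrow> tail E a = w \<Longrightarrow> a = e"
  using out_w in_out_arcs_conv[of a E w] by auto

text \<open>
  Only meaningful on paths not ending in \<open>w\<close>: there every edge into \<open>w\<close> is followed by \<open>e\<close>,
  which \<^const>\<open>tl\<close> drops.
\<close>

fun contract :: "'e list \<Rightarrow> ('e + 'e \<times> 'e) list" where
  "contract [] = []"
| "contract (a # p) = (if head E a = w then Inr (a, e) # contract (tl p) else Inl a # contract p)"

text \<open>Undoes \<open>contract\<close> on paths not ending in w. Working letter by letter it
  preserves prefixes, so prefixes between contracted paths can be read back in
  \<open>E\<close>.\<close>

definition expand :: "('e + 'e \<times> 'e) list \<Rightarrow> 'e list" where
  "expand = concat \<circ> map (case_sum (\<lambda>a. [a]) (\<lambda>(a, b). [a, b]))"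

lemma FP_from_w_Cons:
  assumes "(w, p) \<in> FP E" "path_tgt E (w, p) \<noteq> w"
  obtains p' where "p = e # p'" "(head E e, p') \<in> FP E"
  using assms out_w_eq by (cases p) auto

text \<open>A path from w that does not end in w starts with e, so the letter skipped by
  \<open>contract\<close> is known. The append law allows any q because p does not end in w: no pair
  straddles the junction.\<close>

lemma contract_props:
  assumes "(u, p) \<in> FP E" "path_tgt E (u, p) \<noteq> w"
  shows "(u, contract p) \<in> FP ER" "path_tgt ER (u, contract p) = path_tgt E (u, p)"
    "expand (contract p) = p" "contract (p @ q) = contract p @ contract q"
proof -
  have "(u, contract p) \<in> FP ER \<and> path_tgt ER (u, contract p) = path_tgt E (u, p) \<and>
    expand (contract p) = p \<and> contract (p @ q) = contract p @ contract q"
    using assms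
  proof (induction p arbitrary: u rule: contract.induct)
    case 1
    then show ?case by (simp add: expand_def)
  next
    case (2 a p)
    show ?case
    proof (cases "head E a = w")
      case True
      with "2.prems" obtain p' where p': "p = e # p'" "(head E e, p') \<in> FP E"
        using FP_from_w_Cons[of p] by auto
      have "(head E e, contract p') \<in> FP ER \<and>
          path_tgt ER (head E e, contract p') = path_tgt E (head E e, p') \<and>
          expand (contract p') = p' \<and> contract (p' @ q) = contract p' @ contract q"
        using "2.IH"(1)[OF True, of "head E e"] "2.prems"(2) p' by simp
      with "2.prems"(1) True p' show ?thesis by (simp add: expand_def)
    next
      case False
      with "2.IH"(2)[OF False, of "head E a"] "2.prems" show ?thesis by (simp add: expand_def)
    qed
  qed
  then show "(u, contract p) \<in> FP ER" "path_tgt ER (u, contract p) = path_tgt E (u, p)"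
    "expand (contract p) = p" "contract (p @ q) = contract p @ contract q" by blast+
qed

section \<open>The map on paths and on S(E)\<close>

definition leave_w :: "('v, 'e) path \<Rightarrow> ('v, 'e) path" where
  "leave_w \<alpha> = (fst \<alpha>, if path_tgt E \<alpha> = w then snd \<alpha> @ [e] else snd \<alpha>)"

definition reduce_path :: "('v, 'e) path \<Rightarrow> ('v, 'e + 'e \<times> 'e) path" where
  "reduce_path \<alpha> = (fst \<alpha>, contract (snd (leave_w \<alpha>)))"

lemma fst_leave_w [simp]: "fst (leave_w \<alpha>) = fst \<alpha>"
  and fst_reduce_path [simp]: "fst (reduce_path \<alpha>) = fst \<alpha>"
  by (simp_all add: leave_w_def reduce_path_def)

lemma leave_w_FP:
  assumes "\<alpha> \<in> FP E"
  shows "leave_w \<alpha> \<in> FP E" "path_tgt E (leave_w \<alpha>) = (if path_tgt E \<alpha> = w then head E e else path_tgt E \<alpha>)"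
    "path_tgt E (leave_w \<alpha>) \<noteq> w"
proof -
  obtain u p where \<alpha>: "\<alpha> = (u, p)" by (cases \<alpha>)
  show F: "leave_w \<alpha> \<in> FP E"
    using assms unfolding \<alpha> by (auto simp: leave_w_def FP_append_iff)
  show t: "path_tgt E (leave_w \<alpha>) = (if path_tgt E \<alpha> = w then head E e else path_tgt E \<alpha>)"
    using assms F path_tgt_append[of u p "[e]"] unfolding \<alpha> by (auto simp: leave_w_def)
  show "path_tgt E (leave_w \<alpha>) \<noteq> w" using t head_e by simp
qed

lemma reduce_path_FP:
  assumes "\<alpha> \<in> FP E"
  shows "reduce_path \<alpha> \<in> FP ER"
    "path_tgt ER (reduce_path \<alpha>) = (if path_tgt E \<alpha> = w then head E e else path_tgt E \<alpha>)"
  using contract_props(1,2)[of "fst \<alpha>" "snd (leave_w \<alpha>)"] leave_w_FP[OF assms]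
  by (simp_all add: reduce_path_def leave_w_def)

text \<open>The suffix \<open>r\<close> depends on \<open>t\<close> and \<open>q\<close> alone. In a
  product, the two components with common target t are therefore prolonged by the same
  \<open>r\<close>.\<close>

lemma reduce_path_append:
  assumes q: "(t, q) \<in> FP E"
  obtains r where "\<And>\<alpha>. \<alpha> \<in> FP E \<Longrightarrow> path_tgt E \<alpha> = t \<Longrightarrow>
    reduce_path (fst \<alpha>, snd \<alpha> @ q) = (fst \<alpha>, snd (reduce_path \<alpha>) @ r)"
proof -
  have leave: "snd (leave_w (fst \<alpha>, snd \<alpha> @ q)) = snd \<alpha> @ snd (leave_w (t, q))"
    if "\<alpha> \<in> FP E" "path_tgt E \<alpha> = t" for \<alpha>
    using that q by (cases \<alpha>) (auto simp: leave_w_def path_tgt_append FP_append_iff)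
  show ?thesis
  proof (cases "t = w")
    case False
    show ?thesis
    proof (rule that)
      fix \<alpha> assume \<alpha>: "\<alpha> \<in> FP E" "path_tgt E \<alpha> = t"
      then show "reduce_path (fst \<alpha>, snd \<alpha> @ q) = (fst \<alpha>, snd (reduce_path \<alpha>) @ contract (snd (leave_w (t, q))))"
        using leave[OF \<alpha>] False contract_props(4)[of "fst \<alpha>" "snd \<alpha>" "snd (leave_w (t, q))"]
        by (simp add: reduce_path_def) (simp add: leave_w_def)
    qed
  next
    case True
    \<comment> \<open>The leading e of the prolonged q is already part of
      \<open>leave_w \<alpha>\<close>, so the suffix comes from p' alone.\<close>
    then obtain p' where p': "snd (leave_w (t, q)) = e # p'"
      using leave_w_FP[OF q] FP_from_w_Cons[of "snd (leave_w (t, q))"]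
      by (metis fst_leave_w fst_conv prod.collapse)
    show ?thesis
    proof (rule that)
      fix \<alpha> assume \<alpha>: "\<alpha> \<in> FP E" "path_tgt E \<alpha> = t"
      then have "snd (leave_w \<alpha>) = snd \<alpha> @ [e]" using True by (simp add: leave_w_def)
      moreover have "contract (snd (leave_w \<alpha>) @ p') = contract (snd (leave_w \<alpha>)) @ contract p'"
        using contract_props(4)[of "fst \<alpha>" "snd (leave_w \<alpha>)" p'] leave_w_FP[OF \<alpha>(1)]
        by (metis fst_leave_w prod.collapse)
      ultimately show "reduce_path (fst \<alpha>, snd \<alpha> @ q) = (fst \<alpha>, snd (reduce_path \<alpha>) @ contract p')"
        using leave[OF \<alpha>] p' by (simp add: reduce_path_def)
    qed
  qed
qed

text \<open>Only comparability can be recovered: a path ending in w and the same path followed by e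
  have equal images. Read back by \<open>expand\<close>, both paths are prefixes of
  \<open>leave_w \<beta>\<close>.\<close>

lemma path_prefix_if_reduce_path_prefix:
  assumes "\<alpha> \<in> FP E" "\<beta> \<in> FP E" "path_prefix (reduce_path \<alpha>) (reduce_path \<beta>)"
  shows "path_prefix \<alpha> \<beta> \<or> path_prefix \<beta> \<alpha>"
proof -
  have expand: "expand (snd (reduce_path \<gamma>)) = snd (leave_w \<gamma>)" if "\<gamma> \<in> FP E" for \<gamma>
    using contract_props(3)[of "fst \<gamma>" "snd (leave_w \<gamma>)"] leave_w_FP[OF that]
    by (simp add: reduce_path_def leave_w_def)
  have "prefix (snd (reduce_path \<alpha>)) (snd (reduce_path \<beta>))" "fst \<alpha> = fst \<beta>"
    using assms(3) by (simp_all add: path_prefix_def)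
  then have "prefix (snd (leave_w \<alpha>)) (snd (leave_w \<beta>))"
    unfolding expand[OF assms(1), symmetric] expand[OF assms(2), symmetric]
    by (auto simp: expand_def prefix_def)
  moreover have "prefix (snd \<gamma>) (snd (leave_w \<gamma>))" for \<gamma>
    by (simp add: leave_w_def)
  ultimately have "prefix (snd \<alpha>) (snd (leave_w \<beta>))" "prefix (snd \<beta>) (snd (leave_w \<beta>))"
    using prefix_order.trans by blast+
  then show ?thesis
    using \<open>fst \<alpha> = fst \<beta>\<close> prefix_same_cases by (auto simp: path_prefix_def)
qed

definition reduce_gis :: "('v, 'e) gis \<Rightarrow> ('v, 'e + 'e \<times> 'e) gis" where
  "reduce_gis = restrict (map_option (map_prod reduce_path reduce_path)) (gis_carrier E)"

lemma reduce_gis_Some: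
  "Some (\<alpha>, \<beta>) \<in> gis_carrier E \<Longrightarrow> reduce_gis (Some (\<alpha>, \<beta>)) = Some (reduce_path \<alpha>, reduce_path \<beta>)"
  by (simp add: reduce_gis_def)

lemma reduce_gis_None: "reduce_gis None = None"
  by (simp add: reduce_gis_def)

lemma reduce_gis_mult:
  assumes s: "s \<in> gis_carrier E" and t: "t \<in> gis_carrier E"
  shows "reduce_gis (gis_mult s t) = gis_mult (reduce_gis s) (reduce_gis t)"
proof (cases "s = None \<or> t = None")
  case True
  then show ?thesis by (auto simp: reduce_gis_None)
next
  case False
  then obtain \<alpha> \<beta> \<gamma> \<delta> where st: "s = Some (\<alpha>, \<beta>)" "t = Some (\<gamma>, \<delta>)" by auto
  note red = reduce_gis_Some[OF s[unfolded st]] reduce_gis_Some[OF t[unfolded st]]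
  have paths: "\<alpha> \<in> FP E" "\<beta> \<in> FP E" "path_tgt E \<beta> = path_tgt E \<alpha>"
    "\<gamma> \<in> FP E" "\<delta> \<in> FP E" "path_tgt E \<delta> = path_tgt E \<gamma>"
    using s t st by auto
  note closed = gis_mult_closed[OF s t, unfolded st]
  consider (left) "path_prefix \<beta> \<gamma>" | (right) "path_prefix \<gamma> \<beta>"
    | (none) "\<not> path_prefix \<beta> \<gamma>" "\<not> path_prefix \<gamma> \<beta>" by blast
  then show ?thesis
  proof cases
    case left
    then obtain q where q: "\<gamma> = (fst \<beta>, snd \<beta> @ q)" using path_prefix_iff by blast
    have "(path_tgt E \<alpha>, q) \<in> FP E" using paths q FP_append_iff[of "fst \<beta>" "snd \<beta>" q] by simp
    then obtain r where "\<And>\<alpha>'. \<alpha>' \<in> FP E \<Longrightarrow> path_tgt E \<alpha>' = path_tgt E \<alpha> \<Longrightarrow>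
        reduce_path (fst \<alpha>', snd \<alpha>' @ q) = (fst \<alpha>', snd (reduce_path \<alpha>') @ r)"
      using reduce_path_append by blast
    from this[of \<alpha>] this[of \<beta>] have
      r: "reduce_path (fst \<alpha>, snd \<alpha> @ q) = (fst (reduce_path \<alpha>), snd (reduce_path \<alpha>) @ r)"
        "reduce_path \<gamma> = (fst (reduce_path \<beta>), snd (reduce_path \<beta>) @ r)"
      using paths q by simp_all
    show ?thesis
      unfolding st red gis_mult_left[OF q] gis_mult_left[OF r(2)]
      using closed unfolding gis_mult_left[OF q] by (simp only: reduce_gis_Some r(1))
  next
    case right
    then obtain q where q: "\<beta> = (fst \<gamma>, snd \<gamma> @ q)" using path_prefix_iff by blast
    have "(path_tgt E \<gamma>, q) \<in> FP E" using paths q FP_append_iff[of "fst \<gamma>" "snd \<gamma>" q] by simp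
    then obtain r where "\<And>\<alpha>'. \<alpha>' \<in> FP E \<Longrightarrow> path_tgt E \<alpha>' = path_tgt E \<gamma> \<Longrightarrow>
        reduce_path (fst \<alpha>', snd \<alpha>' @ q) = (fst \<alpha>', snd (reduce_path \<alpha>') @ r)"
      using reduce_path_append by blast
    from this[of \<delta>] this[of \<gamma>] have
      r: "reduce_path (fst \<delta>, snd \<delta> @ q) = (fst (reduce_path \<delta>), snd (reduce_path \<delta>) @ r)"
        "reduce_path \<beta> = (fst (reduce_path \<gamma>), snd (reduce_path \<gamma>) @ r)"
      using paths q by simp_all
    show ?thesis
      unfolding st red gis_mult_right[OF q] gis_mult_right[OF r(2)]
      using closed unfolding gis_mult_right[OF q] by (simp only: reduce_gis_Some r(1))
  next
    case none
    then have "gis_mult (Some (\<alpha>, \<beta>)) (Some (\<gamma>, \<delta>)) = None" by simp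
    moreover have "gis_mult (Some (reduce_path \<alpha>, reduce_path \<beta>)) (Some (reduce_path \<gamma>, reduce_path \<delta>)) = None"
      using none path_prefix_if_reduce_path_prefix[of \<beta> \<gamma>] path_prefix_if_reduce_path_prefix[of \<gamma> \<beta>] paths
      unfolding gis_mult_eq_None by blast
    ultimately show ?thesis unfolding st red by (simp only: reduce_gis_None)
  qed
qed

lemma ext_path_hom_reduce_gis: "ext_path_hom E ER reduce_gis"
  unfolding ext_path_hom_def
proof (intro conjI ballI)
  show "reduce_gis \<in> gis_carrier E \<rightarrow>\<^sub>E gis_carrier ER"
  proof (rule PiE_I)
    fix s assume s: "s \<in> gis_carrier E"
    show "reduce_gis s \<in> gis_carrier ER"
    proof (cases s)
      case (Some ab)
      then obtain \<alpha> \<beta> where s': "s = Some (\<alpha>, \<beta>)" by (cases ab) auto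
      with s show ?thesis by (simp add: reduce_gis_Some reduce_path_FP)
    qed (simp add: reduce_gis_None)
  qed (simp add: reduce_gis_def)
qed (auto simp: reduce_gis_mult reduce_gis_None)

lemma reduce_gis_vert:
  assumes "u \<in> verts E"
  shows "reduce_gis (Some (vpath u, vpath u)) =
    (if u \<noteq> w then Some (vpath u, vpath u) else Some (epath ER (Inl e), epath ER (Inl e)))"
  using assms head_e
  by (simp add: reduce_gis_Some vpath_def epath_def reduce_path_def leave_w_def)

lemma reduce_path_arc:
  assumes "a \<in> arcs E"
  shows "reduce_path (epath E a) = epath ER (if head E a = w then Inr (a, e) else Inl a)"
  using assms by (simp add: epath_def reduce_path_def leave_w_def)

lemma reduce_gis_edge:
  assumes "a \<in> arcs E"
  shows "reduce_gis (Some (epath E a, vpath (head E a))) =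
    (if head E a \<noteq> w then Some (epath ER (Inl a), vpath (head E a))
     else Some (epath ER (Inr (a, e)), epath ER (Inl e)))"
  using assms head_e
  by (simp add: reduce_gis_Some vpath_def epath_def reduce_path_def leave_w_def)

text \<open>A nonzero element below the image of (u,u) is (\<gamma>,\<gamma>) with \<gamma>
  prolonging the image of u. The product is nonzero once \<gamma> is comparable with the image of
  some edge leaving u.\<close>

lemma regular_hom_reduce_gis: "regular_hom E ER reduce_gis"
  unfolding regular_hom_def
proof (intro ballI impI, elim conjE)
  fix u t
  assume u: "u \<in> reg E" and t: "t \<in> gis_carrier ER" "t \<noteq> None"
    and le: "gis_le t (reduce_gis (Some (vpath u, vpath u)))"
  have u': "u \<in> verts E" "out_arcs E u \<noteq> {}" using u by (auto simp: reg_def)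
  obtain \<gamma> \<delta> where \<gamma>\<delta>: "t = Some (\<gamma>, \<delta>)" using t(2) by auto
  have red_u: "reduce_gis (Some (vpath u, vpath u)) = Some (reduce_path (vpath u), reduce_path (vpath u))"
    using u' by (simp add: reduce_gis_Some vpath_def)
  have \<delta>: "\<delta> = \<gamma>" and pre: "path_prefix (reduce_path (vpath u)) \<gamma>"
    using gis_le_idempotent le unfolding \<gamma>\<delta> red_u by blast+
  have \<gamma>: "\<gamma> \<in> FP ER" using t(1) unfolding \<gamma>\<delta> by simp
  have red_arc: "reduce_gis (Some (epath E a, epath E a)) =
      Some (epath ER (if head E a = w then Inr (a, e) else Inl a),
        epath ER (if head E a = w then Inr (a, e) else Inl a))" if "a \<in> arcs E" for a
    using reduce_gis_Some[of "epath E a" "epath E a"] that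
    by (simp add: reduce_path_arc) (simp add: epath_def)
  have "\<exists>a\<in>out_arcs E u. path_prefix \<gamma> (reduce_path (epath E a)) \<or> path_prefix (reduce_path (epath E a)) \<gamma>"
  proof (cases "u = w")
    case True
    \<comment> \<open>The vertex w and the edge e have the same image, so the known prefix is
      already the wanted one.\<close>
    have "reduce_path (vpath u) = reduce_path (epath E e)"
      using True head_e by (simp add: reduce_path_arc) (simp add: reduce_path_def leave_w_def vpath_def epath_def)
    then show ?thesis using True pre out_w by simp
  next
    case False
    then have "reduce_path (vpath u) = (u, [])" by (simp add: reduce_path_def leave_w_def vpath_def)
    then obtain q where q: "\<gamma> = (u, q)" using pre by (auto simp: path_prefix_iff)
    show ?thesis
    proof (cases q)
      case Nil
      \<comment> \<open>Here \<gamma> is the vertex u, a prefix of the image of every edge leaving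
        u.\<close>
      then show ?thesis using u' q by (auto simp: path_prefix_def epath_def)
    next
      case (Cons x q')
      then have x: "x \<in> arcs ER" "tail ER x = u" using \<gamma> q by simp_all
      \<comment> \<open>Each edge of \<open>ER\<close> is the image of an edge of \<open>E\<close>
        with the same source: an old edge of itself, a pair of its first component.\<close>
      obtain a where a: "a \<in> arcs E" "tail E a = u" "x = (if head E a = w then Inr (a, e) else Inl a)"
      proof (cases x)
        case (Inl a)
        then show ?thesis using that[of a] x by auto
      next
        case (Inr ab)
        then show ?thesis using that[of "fst ab"] x by (cases ab) auto
      qed
      have "reduce_path (epath E a) = (u, [x])"
        unfolding reduce_path_arc[OF a(1)] a(3)[symmetric] using x by (simp add: epath_def)
      then have "path_prefix (reduce_path (epath E a)) \<gamma>"
        using q Cons by (simp add: path_prefix_def)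
      then show ?thesis using a by auto
    qed
  qed
  then obtain a where a: "a \<in> out_arcs E u"
    and comp: "path_prefix \<gamma> (reduce_path (epath E a)) \<or> path_prefix (reduce_path (epath E a)) \<gamma>" by blast
  have "gis_mult t (reduce_gis (Some (epath E a, epath E a))) \<noteq> None"
    using comp a unfolding \<gamma>\<delta> \<delta> by (simp only: red_arc reduce_path_arc in_out_arcs_conv gis_mult_eq_None) blast
  then show "\<exists>a\<in>out_arcs E u. gis_mult t (reduce_gis (Some (epath E a, epath E a))) \<noteq> None"
    using a by blast
qed

end

section \<open>The induced homomorphism\<close>

context wf_digraph
begin

lemma star_hom_graph_cstar_eqI:
  assumes "wf_digraph F"
    and hom: "star_hom (graph_cstar G) (graph_cstar F) \<psi>" "star_hom (graph_cstar G) (graph_cstar F) \<psi>'"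
    and vert: "\<And>v. v \<in> verts G \<Longrightarrow> \<psi> (S_vert G v) = \<psi>' (S_vert G v)"
    and edge: "\<And>a. a \<in> arcs G \<Longrightarrow> \<psi> (S_edge G a) = \<psi>' (S_edge G a)"
    and X: "X \<in> cs_carrier (graph_cstar G)"
  shows "\<psi> X = \<psi>' X"
proof -
  interpret F: wf_digraph F by fact
  show ?thesis
  proof (rule star_hom_eqI[OF CK.bounded_relations_axioms F.CK.bounded_relations_axioms])
    fix x assume "x \<in> ck_gens G"
    then show "\<psi> (univ_gen (ck_gens G) (ck_rels G) x) = \<psi>' (univ_gen (ck_gens G) (ck_rels G) x)"
      using vert edge by (auto simp: ck_gens_def S_vert_def S_edge_def)
  qed (use hom X in \<open>simp_all add: graph_cstar_def\<close>)
qed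

text \<open>Two inducing maps agree on the generators, hence on the carrier, and extensionality
  settles the rest; so \<open>THE\<close> picks the given one.\<close>

lemma induced_hom_eqI:
  assumes F: "wf_digraph F" and \<psi>: "induces G F \<phi> \<psi>"
  shows "induced_hom G F \<phi> = \<psi>"
  unfolding induced_hom_def
proof (rule the_equality[where P = "induces G F \<phi>", OF \<psi>])
  fix \<psi>' assume \<psi>': "induces G F \<phi> \<psi>'"
  show "\<psi>' = \<psi>"
  proof (rule extensionalityI[where A = "cs_carrier (graph_cstar G)"])
    fix X assume X: "X \<in> cs_carrier (graph_cstar G)"
    show "\<psi>' X = \<psi> X"
      by (rule star_hom_graph_cstar_eqI[OF F _ _ _ _ X]) (use \<psi> \<psi>' in \<open>simp_all add: induces_def\<close>)
  qed (use \<psi> \<psi>' in \<open>simp_all add: induces_def\<close>)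
qed

lemma star_hom_restrict:
  assumes "star_hom (graph_cstar G) B \<psi>"
  shows "star_hom (graph_cstar G) B (restrict \<psi> (cs_carrier (graph_cstar G)))"
  using assms CK.carrier_closed unfolding star_hom_def graph_cstar_def by auto

end

lemma S_path_vpath [simp]: "S_path E (vpath v) = S_vert E v"
  and S_path_epath [simp]: "S_path E (epath E a) = S_edge E a"
  by (simp_all add: vpath_def epath_def)

theorem theorem5p24:
  fixes E :: "('v, 'e) pre_digraph" and w :: 'v and e :: 'e
    and f :: "('v, 'e + 'e \<times> 'e) gcs \<Rightarrow> ('v, 'e) gcs"
    and \<phi>0 :: "'v \<Rightarrow> ('v, 'e + 'e \<times> 'e) gis"
    and \<phi>1 :: "'e \<Rightarrow> ('v, 'e + 'e \<times> 'e) gis"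
  defines "ER \<equiv> unital_reduction E w"
  assumes graph: "wf_digraph E"
    and w: "w \<in> verts E" "out_arcs E w = {e}" "head E e \<noteq> w"
    and f_iso: "star_iso (graph_cstar ER) (graph_cstar E) f"
    and f_vert: "\<And>v. v \<in> verts E \<Longrightarrow> f (S_vert ER v) = S_vert E v"
    and f_old: "\<And>g. g \<in> arcs E - in_arcs E w \<Longrightarrow> f (S_edge ER (Inl g)) = S_edge E g"
    and f_new: "\<And>g. g \<in> in_arcs E w \<Longrightarrow>
      f (S_edge ER (Inr (g, e))) = cs_mult (graph_cstar E) (S_edge E g) (S_edge E e)"
    and phi0: "\<And>u. u \<in> verts E \<Longrightarrow> \<phi>0 u =
      (if u \<noteq> w then Some (vpath u, vpath u)
       else Some (epath ER (Inl e), epath ER (Inl e)))"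
    and phi1: "\<And>g. g \<in> arcs E \<Longrightarrow> \<phi>1 g =
      (if head E g \<noteq> w then Some (epath ER (Inl g), vpath (head E g))
       else Some (epath ER (Inr (g, e)), epath ER (Inl e)))"
  shows "\<exists>\<phi>. determines E ER \<phi>0 \<phi>1 \<phi> \<and> regular_hom E ER \<phi> \<and>
    induces E ER \<phi> (induced_hom E ER \<phi>) \<and>
    induced_hom E ER \<phi> =
      restrict (inv_into (cs_carrier (graph_cstar ER)) f) (cs_carrier (graph_cstar E))"
proof -
  interpret E: reducible_vertex E w e
    using graph w by (simp add: reducible_vertex_def reducible_vertex_axioms_def)
  interpret ER: wf_digraph ER
    unfolding ER_def by (rule E.wf_digraph_unital_reduction)
  let ?A = "graph_cstar ER" and ?B = "graph_cstar E" and ?\<phi> = "E.reduce_gis"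
  \<comment> \<open>The restriction provides the extensionality that \<open>induces\<close> asks
    for.\<close>
  define g where "g = restrict (inv_into (cs_carrier ?A) f) (cs_carrier ?B)"
  note ER_simps = E.ER_simps[folded ER_def]

  have hom_\<phi>: "ext_path_hom E ER ?\<phi>"
    unfolding ER_def by (rule E.ext_path_hom_reduce_gis)
  have gens_\<phi>: "extends_gens E \<phi>0 \<phi>1 ?\<phi>"
    unfolding extends_gens_def
    using E.reduce_gis_vert E.reduce_gis_edge by (simp add: phi0 phi1 ER_def)
  have "determines E ER \<phi>0 \<phi>1 ?\<phi>"
    unfolding determines_def using hom_\<phi> gens_\<phi> E.ext_path_hom_eqI by blast

  have inv_f: "inv_into (cs_carrier ?A) f (f X) = X" if "X \<in> cs_carrier ?A" for X
    using f_iso that by (simp add: star_iso_def bij_betw_def)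
  have f_mult: "f (cs_mult ?A X Y) = cs_mult ?B (f X) (f Y)"
    if "X \<in> cs_carrier ?A" "Y \<in> cs_carrier ?A" for X Y
    using f_iso that by (simp add: star_iso_def star_hom_def)
  have f_star: "f (cs_star ?A X) = cs_star ?B (f X)" if "X \<in> cs_carrier ?A" for X
    using f_iso that by (simp add: star_iso_def star_hom_def)
  have S_vert: "S_vert ER v \<in> cs_carrier ?A" if "v \<in> verts E" for v
    using that by (intro ER.S_vert_in_carrier) (simp add: ER_simps)
  have S_old: "S_edge ER (Inl a) \<in> cs_carrier ?A" "f (S_edge ER (Inl a)) = S_edge E a"
    if "a \<in> arcs E" "head E a \<noteq> w" for a
    using that f_old by (auto intro!: ER.S_edge_in_carrier simp: ER_simps)
  have S_new: "S_edge ER (Inr (a, e)) \<in> cs_carrier ?A"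
    "f (S_edge ER (Inr (a, e))) = cs_mult ?B (S_edge E a) (S_edge E e)"
    if "a \<in> arcs E" "head E a = w" for a
    using that f_new by (auto intro!: ER.S_edge_in_carrier simp: ER_simps)
  note S_e = S_old[OF E.e(1) w(3)]
  note S_w = E.cs_mult_S_edge_star[OF w(1,2)]

  \<comment> \<open>Values are known for f, so f is evaluated at the candidates; carrier membership
    then lets \<open>inv_f\<close> turn this into a value of g. At w the identity S_w = S_e S_e^*
    enters.\<close>
  have "f (S_gis ER (\<phi>0 v)) = S_vert E v \<and> S_gis ER (\<phi>0 v) \<in> cs_carrier ?A"
    if "v \<in> verts E" for v
    using that S_vert[OF that] S_e S_w
    by (simp add: phi0 f_mult f_star ER.graph_cs_mult_closed ER.graph_cs_star_closed f_vert E.cs_star_S_vert E.cs_mult_S_vert)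
  then have vert: "g (S_vert E v) = S_gis ER (\<phi>0 v)" if "v \<in> verts E" for v
    using that inv_f E.S_vert_in_carrier by (metis g_def restrict_apply')
  have "f (S_gis ER (\<phi>1 a)) = S_edge E a \<and> S_gis ER (\<phi>1 a) \<in> cs_carrier ?A"
    if a: "a \<in> arcs E" for a
  proof (cases "head E a = w")
    case True
    \<comment> \<open>S_a S_e S_e^* = S_a S_w = S_a, as a ends in w.\<close>
    have "cs_mult ?B (cs_mult ?B (S_edge E a) (S_edge E e)) (cs_star ?B (S_edge E e)) = S_edge E a"
      using a True S_w E.cs_mult_S_edge_S_vert[OF a]
      by (simp add: E.cs_mult_assoc E.S_edge_in_carrier E.graph_cs_mult_closed E.graph_cs_star_closed)
    with a True S_new[OF a True] S_e show ?thesis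
      by (simp add: phi1 f_mult f_star ER.graph_cs_mult_closed ER.graph_cs_star_closed)
  next
    case False
    with a S_old[OF a False] S_vert[of "head E a"] show ?thesis
      by (simp add: phi1 f_mult f_star ER.graph_cs_mult_closed ER.graph_cs_star_closed f_vert E.cs_star_S_vert
          E.cs_mult_S_edge_S_vert)
  qed
  then have edge: "g (S_edge E a) = S_gis ER (\<phi>1 a)" if "a \<in> arcs E" for a
    using that inv_f E.S_edge_in_carrier by (metis g_def restrict_apply')

  have "star_hom ?B ?A (inv_into (cs_carrier ?A) f)"
    using star_hom_inv_into[OF ER.CK.bounded_relations_axioms] f_iso
    unfolding graph_cstar_def by blast
  then have "star_hom ?B ?A g"
    unfolding g_def by (rule E.star_hom_restrict)
  then have "induces E ER ?\<phi> g"
    unfolding induces_def using vert edge gens_\<phi> by (simp add: extends_gens_def g_def)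
  moreover from this have "induced_hom E ER ?\<phi> = g"
    by (rule E.induced_hom_eqI[OF ER.wf_digraph_axioms])
  ultimately show ?thesis
    using \<open>determines E ER \<phi>0 \<phi>1 ?\<phi>\<close> E.regular_hom_reduce_gis unfolding g_def ER_def by metis
qed

end
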